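(* Let $G,H$ be groups equipped with conjugation-invariant norms, let $T$ be a scaling set, and let $f\colon G\to H$ be a surjective homomorphism, Lipschitz with constant $C$. Assume further that (a) $\ker(f)$ is a bounded subgroup of $G$; (b) $f$ admits a set-theoretic section $s\colon H\to G$ (not necessarily a homomorphism) such that there exists $C'$ with $\|s(h)\|_G\le C'\|h\|_H$ for all $h\in H$. Then $\hat{\mathcal{C}}(f,T)\colon\hat{\mathcal{C}}(G,T)\to\hat{\mathcal{C}}(H,T)$, $[g]\mapsto[f\circ g]$, is an isomorphism, Lipschitz with constant $C$, whose inverse is the homomorphism $$s_!\colon\hat{\mathcal{C}}(H,T)\to\hat{\mathcal{C}}(G,T),\qquad[h]\mapsto[s\circ h],$$ which is Lipschitz with constant $C'$.
   Context: Norms. A norm on a group $G$ is a function $\|\cdot\|\colon G\to[0,\infty)$ with $\|g\|=0\iff g=1$, $\|g^{-1}\|=\|g\|$ and $\|gh\|\le\|g\|+\|h\|$; for a pseudonorm one only requires $\|1\|=0$ instead of the first condition. It is conjugation-invariant if $\|hgh^{-1}\|=\|g\|$ for all $g,h$. It induces the bi-invariant (pseudo)metric $d(g,h)=\|g^{-1}h\|$; all metric notions refer to it. A homomorphism $\varphi$ is Lipschitz with constant $C$ iff $\|\varphi(g)\|\le C\|g\|$ for all $g$. The groups $F_{\mathbb{R}}(G)$ and $F(G)$. Let $G$ be a group with a conjugation-invariant norm. $F_{\mathbb{R}}(G)$ is the free product of copies of the additive group $\mathbb{R}$ indexed by the elements $g$ of the set $G$; the element $r$ of the copy indexed by $g$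 is written $\overline{g}(r)$. It carries the conjugation-invariant pseudonorm $$\|x\|=\inf\Big\{\sum_{i=1}^n |r_i|\,\|g_i\| : x=\prod_{i=1}^n h_i\,\overline{g_i}(r_i)^{\pm1}h_i^{-1},\ h_i\in F_{\mathbb{R}}(G)\Big\}.$$ $F(G)\le F_{\mathbb{R}}(G)$ is the subgroup generated by the elements $\overline{g}:=\overline{g}(1)$; it is free on $\{\overline{g}: g\in G\}$. For $t\in\mathbb{R}$, $\psi_t\colon F_{\mathbb{R}}(G)\to F_{\mathbb{R}}(G)$ is the homomorphism with $\psi_t(\overline{g}(r))=\overline{g}(tr)$. $\pi\colon F(G)\to G$ is the homomorphism with $\pi(\overline{g})=g$. Directional asymptotic cone. A scaling set is an unbounded subset $T\subseteq(0,\infty)$; limits over $t\in T$ are taken as $t\to\infty$. A function $f$ from $T$ to a pseudometric space is Cauchy if for every $\epsilon>0$, $d(f(t),f(t'))<\epsilon$ for all sufficiently large $t,t'\in T$. $\mathcal{D}(G,T)$ is the group (pointwise product) of all functions $w\colon T\to F(G)$ such that $t\mapsto\psi_{1/t}(w(t))\in F_{\mathbb{R}}(G)$ is Cauchy, with pseudonorm $\|w\|=\lim_{t\in T}\|\psi_{1/t}(w(t))\|$. $\mathcal{C}(G,T)=\{\pi\circ w: w\in\mathcal{D}(G,T)\}$, a group of functions $T\to G$, with pseudonorm $\|g\|=\inf\{\|w\|: w\in\mathcal{D}(G,T),\ \pi\circ w=g\}$. The directional asymptotic cone $\hat{\mathcal{C}}(G,T)$ is the quotient of $\mathcal{C}(G,T)$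 by the normal subgroup of elements of pseudonorm $0$, with the induced conjugation-invariant norm; $[g]$ denotes the class of $g$. Any Lipschitz homomorphism $\varphi\colon G\to H$ induces a well-defined Lipschitz homomorphism $\hat{\mathcal{C}}(\varphi,T)\colon\hat{\mathcal{C}}(G,T)\to\hat{\mathcal{C}}(H,T)$, $[g]\mapsto[\varphi\circ g]$. *)

theory Defs
  imports Complex_Main "HOL-Algebra.Product_Groups"
begin

section \<open>Norms on groups\<close>

definition group_norm :: "('a, 'x) monoid_scheme \<Rightarrow> ('a \<Rightarrow> real) \<Rightarrow> bool" where
  "group_norm G N \<longleftrightarrow>
     (\<forall>g\<in>carrier G. N g \<ge> 0 \<and> (N g = 0 \<longleftrightarrow> g = \<one>\<^bsub>G\<^esub>) \<and> N (inv\<^bsub>G\<^esub> g) = N g) \<and>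
     (\<forall>g\<in>carrier G. \<forall>h\<in>carrier G. N (g \<otimes>\<^bsub>G\<^esub> h) \<le> N g + N h)"

definition conj_invariant :: "('a, 'x) monoid_scheme \<Rightarrow> ('a \<Rightarrow> real) \<Rightarrow> bool" where
  "conj_invariant G N \<longleftrightarrow>
     (\<forall>g\<in>carrier G. \<forall>h\<in>carrier G. N (h \<otimes>\<^bsub>G\<^esub> g \<otimes>\<^bsub>G\<^esub> inv\<^bsub>G\<^esub> h) = N g)"

definition group_dist :: "('a, 'x) monoid_scheme \<Rightarrow> ('a \<Rightarrow> real) \<Rightarrow> 'a \<Rightarrow> 'a \<Rightarrow> real" where
  "group_dist G N g h = N (inv\<^bsub>G\<^esub> g \<otimes>\<^bsub>G\<^esub> h)"

definition norm_bounded :: "('a, 'x) monoid_scheme \<Rightarrow> ('a \<Rightarrow> real) \<Rightarrow> 'a set \<Rightarrow> bool" where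
  "norm_bounded G N S \<longleftrightarrow> (\<exists>B. \<forall>x\<in>S. \<forall>y\<in>S. group_dist G N x y \<le> B)"

text \<open>The condition is also used for maps that are not homomorphisms (such as a section).\<close>

definition norm_lipschitz ::
  "('a, 'x) monoid_scheme \<Rightarrow> ('a \<Rightarrow> real) \<Rightarrow> ('b \<Rightarrow> real) \<Rightarrow> real \<Rightarrow> ('a \<Rightarrow> 'b) \<Rightarrow> bool" where
  "norm_lipschitz G N M C \<phi> \<longleftrightarrow> (\<forall>g\<in>carrier G. M (\<phi> g) \<le> C * N g)"


section \<open>Free products of copies of the real line\<close>

text \<open>
  Elements of the free product of copies of the additive group of the reals indexed by a set \<open>A\<close>
  are represented by their normal forms: words of letters \<open>(a, r)\<close> with \<open>a \<in> A\<close> and \<open>r \<noteq> 0\<close>,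
  in which adjacent letters come from different copies.
\<close>

type_synonym 'a rword = "('a \<times> real) list"

definition rwords :: "'a set \<Rightarrow> 'a rword set" where
  "rwords A = {w. (\<forall>(a, r)\<in>set w. a \<in> A \<and> r \<noteq> 0) \<and> distinct_adj (map fst w)}"

text \<open>Left multiplication of a normal form by one letter (\<open>r = 0\<close> allowed).\<close>

fun push :: "'a \<times> real \<Rightarrow> 'a rword \<Rightarrow> 'a rword" where
  "push (a, r) [] = (if r = 0 then [] else [(a, r)])"
| "push (a, r) ((b, s) # w) =
     (if r = 0 then (b, s) # w
      else if a = b then (if r + s = 0 then w else (a, r + s) # w)
      else (a, r) # (b, s) # w)"

definition free_real :: "'a set \<Rightarrow> 'a rword monoid" where
  "free_real A = \<lparr>carrier = rwords A, monoid.mult = foldr push, one = []\<rparr>"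

definition letter :: "'a \<Rightarrow> real \<Rightarrow> 'a rword" where
  "letter a r = (if r = 0 then [] else [(a, r)])"

definition extend_letters :: "('b, 'x) monoid_scheme \<Rightarrow> ('a \<Rightarrow> real \<Rightarrow> 'b) \<Rightarrow> 'a rword \<Rightarrow> 'b" where
  "extend_letters K \<phi> w = foldr (\<lambda>(a, r) y. \<phi> a r \<otimes>\<^bsub>K\<^esub> y) w \<one>\<^bsub>K\<^esub>"

lemma carrier_free_real [simp]: "carrier (free_real A) = rwords A"
  and mult_free_real: "u \<otimes>\<^bsub>free_real A\<^esub> v = foldr push u v"
  and one_free_real [simp]: "\<one>\<^bsub>free_real A\<^esub> = []"
  by (simp_all add: free_real_def)

lemma Nil_rwords [simp]: "[] \<in> rwords A"
  by (simp add: rwords_def)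

lemma rwords_Cons:
  "(a, r) # w \<in> rwords A \<longleftrightarrow>
     a \<in> A \<and> r \<noteq> 0 \<and> w \<in> rwords A \<and> (case w of [] \<Rightarrow> True | (b, s) # _ \<Rightarrow> a \<noteq> b)"
  by (cases w) (auto simp: rwords_def)

lemma letter_rwords [simp]: "a \<in> A \<Longrightarrow> letter a r \<in> rwords A"
  by (simp add: letter_def rwords_Cons)

lemma push_rwords: "a \<in> A \<Longrightarrow> w \<in> rwords A \<Longrightarrow> push (a, r) w \<in> rwords A"
  by (cases w) (auto simp: rwords_Cons split: list.splits)

lemma push_Cons_eq: "(a, r) # w \<in> rwords A \<Longrightarrow> push (a, r) w = (a, r) # w"
  by (cases w) (auto simp: rwords_Cons)

lemma push_zero [simp]: "push (a, 0) w = w"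
  by (cases w) auto

lemma push_push: "w \<in> rwords A \<Longrightarrow> push (a, r) (push (a, s) w) = push (a, r + s) w"
  by (cases w) (auto simp: rwords_Cons split: list.splits)

lemma foldr_push_rwords: "u \<in> rwords A \<Longrightarrow> v \<in> rwords A \<Longrightarrow> foldr push u v \<in> rwords A"
  by (induction u) (auto simp: rwords_Cons push_rwords)

lemma foldr_push_Nil: "u \<in> rwords A \<Longrightarrow> foldr push u [] = u"
  by (induction u) (auto simp: rwords_Cons intro!: push_Cons_eq)

lemma foldr_push_push:
  assumes "v \<in> rwords A" "w \<in> rwords A"
  shows "foldr push (push (a, r) v) w = push (a, r) (foldr push v w)"
proof (cases v)
  case (Cons p v')
  obtain b s where p: "p = (b, s)"
    by (cases p)
  have "foldr push v' w \<in> rwords A"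
    using assms Cons p by (auto simp: rwords_Cons intro: foldr_push_rwords)
  then show ?thesis
    using Cons p push_push[of "foldr push v' w" A a r s] by (auto simp: add_eq_0_iff)
qed auto

lemma foldr_push_assoc:
  assumes "u \<in> rwords A" "v \<in> rwords A" "w \<in> rwords A"
  shows "foldr push (foldr push u v) w = foldr push u (foldr push v w)"
  using assms
  by (induction u) (auto simp: rwords_Cons foldr_push_push[of _ A] foldr_push_rwords)

lemma free_real_inverse:
  assumes "w \<in> rwords A"
  shows "\<exists>v\<in>rwords A. foldr push w v = [] \<and> foldr push v w = []"
  using assms
proof (induction w)
  case (Cons p w)
  obtain a r where p: "p = (a, r)"
    by (cases p)
  have w: "w \<in> rwords A" "a \<in> A" "r \<noteq> 0"
    using Cons.prems p by (auto simp: rwords_Cons)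
  then obtain v where v: "v \<in> rwords A" "foldr push w v = []" "foldr push v w = []"
    using Cons.IH by blast
  let ?l = "[(a, - r)]"
  have l: "?l \<in> rwords A"
    using w by (simp add: rwords_Cons)
  have "foldr push (p # w) (foldr push v ?l) = push p (foldr push (foldr push w v) ?l)"
    using foldr_push_assoc[OF w(1) v(1) l] by simp
  also have "\<dots> = []"
    using v p w by simp
  finally have 1: "foldr push (p # w) (foldr push v ?l) = []" .
  have "foldr push (foldr push v ?l) (p # w) = foldr push v (push (a, - r) (p # w))"
    using foldr_push_assoc[OF v(1) l Cons.prems] by simp
  also have "\<dots> = []"
    using v p w by simp
  finally show ?case
    using 1 foldr_push_rwords[OF v(1) l] by blast
qed auto

lemma group_free_real: "group (free_real A)"
proof (rule groupI)
  fix w assume "w \<in> carrier (free_real A)"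
  then show "\<exists>v\<in>carrier (free_real A). v \<otimes>\<^bsub>free_real A\<^esub> w = \<one>\<^bsub>free_real A\<^esub>"
    using free_real_inverse[of w A] by (auto simp: mult_free_real)
qed (auto simp: mult_free_real foldr_push_rwords foldr_push_assoc)

lemma letter_mult: "letter a r \<otimes>\<^bsub>free_real A\<^esub> letter a s = letter a (r + s)"
  by (auto simp: mult_free_real letter_def)

lemma extend_letters_letter:
  assumes "group K" "\<phi> a r \<in> carrier K" "\<phi> a 0 = \<one>\<^bsub>K\<^esub>"
  shows "extend_letters K \<phi> (letter a r) = \<phi> a r"
  using assms by (simp add: extend_letters_def letter_def group.is_monoid monoid.r_one)

text \<open>
  Homomorphisms on the individual copies extend to the free product.  The maps need only be additive
  on a set \<open>R\<close> of exponents: \<open>proj\<close> below uses the integers.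
\<close>

lemma extend_letters_mult:
  assumes K: "group K"
    and R: "\<And>r s. r \<in> R \<Longrightarrow> s \<in> R \<Longrightarrow> r + s \<in> R"
    and closed: "\<And>a r. a \<in> A \<Longrightarrow> r \<in> R \<Longrightarrow> \<phi> a r \<in> carrier K"
    and zero: "\<And>a. a \<in> A \<Longrightarrow> \<phi> a 0 = \<one>\<^bsub>K\<^esub>"
    and add: "\<And>a r s. a \<in> A \<Longrightarrow> r \<in> R \<Longrightarrow> s \<in> R \<Longrightarrow> \<phi> a (r + s) = \<phi> a r \<otimes>\<^bsub>K\<^esub> \<phi> a s"
    and u: "u \<in> rwords A" "snd ` set u \<subseteq> R"
    and v: "v \<in> rwords A" "snd ` set v \<subseteq> R"
  shows "extend_letters K \<phi> (foldr push u v) = extend_letters K \<phi> u \<otimes>\<^bsub>K\<^esub> extend_letters K \<phi> v"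
    and "snd ` set (foldr push u v) \<subseteq> R"
    and "extend_letters K \<phi> u \<in> carrier K"
proof -
  interpret group K by fact
  let ?E = "extend_letters K \<phi>"
  have E_Nil: "?E [] = \<one>\<^bsub>K\<^esub>" and E_Cons: "\<And>a r w. ?E ((a, r) # w) = \<phi> a r \<otimes>\<^bsub>K\<^esub> ?E w"
    by (simp_all add: extend_letters_def)
  have E_closed: "?E w \<in> carrier K" if "w \<in> rwords A" "snd ` set w \<subseteq> R" for w
    using that by (induction w) (auto simp: E_Nil E_Cons rwords_Cons closed)
  have E_push: "?E (push (a, r) w) = \<phi> a r \<otimes>\<^bsub>K\<^esub> ?E w \<and> snd ` set (push (a, r) w) \<subseteq> R"
    if a: "a \<in> A" and r: "r \<in> R" and w: "w \<in> rwords A" "snd ` set w \<subseteq> R" for a r w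
  proof (cases w)
    case Nil
    then show ?thesis
      using a r zero closed by (auto simp: E_Nil E_Cons)
  next
    case (Cons p w')
    obtain b s where p: "p = (b, s)"
      by (cases p)
    have w': "b \<in> A" "s \<in> R" "?E w' \<in> carrier K" "snd ` set w' \<subseteq> R"
      using w Cons p by (auto simp: rwords_Cons E_closed)
    have *: "\<phi> a r \<otimes>\<^bsub>K\<^esub> (\<phi> a s \<otimes>\<^bsub>K\<^esub> ?E w') = \<phi> a (r + s) \<otimes>\<^bsub>K\<^esub> ?E w'" if "a = b"
      using a r w' that closed add[of a r s] by (simp add: m_assoc)
    show ?thesis
      using Cons p a r w' * zero[OF a] R[of r s] closed by (auto simp: E_Nil E_Cons)
  qed
  have "?E (foldr push u v) = ?E u \<otimes>\<^bsub>K\<^esub> ?E v \<and> snd ` set (foldr push u v) \<subseteq> R"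
    using u
  proof (induction u)
    case Nil
    then show ?case
      using v by (simp add: E_Nil E_closed)
  next
    case (Cons p u)
    obtain a r where p: "p = (a, r)"
      by (cases p)
    show ?case
      using Cons p v E_push[of a r "foldr push u v"]
      by (auto simp: rwords_Cons foldr_push_rwords E_Cons E_closed closed m_assoc)
  qed
  then show "?E (foldr push u v) = ?E u \<otimes>\<^bsub>K\<^esub> ?E v" "snd ` set (foldr push u v) \<subseteq> R"
    by auto
  show "?E u \<in> carrier K"
    using u by (rule E_closed)
qed


section \<open>The groups \<open>F\<^sub>\<real>(G)\<close> and \<open>F(G)\<close>\<close>

abbreviation FR :: "('a, 'x) monoid_scheme \<Rightarrow> 'a rword monoid" where
  "FR G \<equiv> free_real (carrier G)"

definition FZ :: "('a, 'x) monoid_scheme \<Rightarrow> 'a rword monoid" where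
  "FZ G = (FR G)\<lparr>carrier := generate (FR G) ((\<lambda>g. letter g 1) ` carrier G)\<rparr>"

text \<open>
  An entry \<open>(h, g, r, e)\<close> of the list stands for the \<open>h\<close>-conjugate of the \<open>e\<close>-th power
  (\<open>e = 1\<close> or \<open>e = -1\<close>) of the element \<open>r\<close> of the copy indexed by \<open>g\<close>.
\<close>

definition FR_norm :: "('a, 'x) monoid_scheme \<Rightarrow> ('a \<Rightarrow> real) \<Rightarrow> 'a rword \<Rightarrow> real" where
  "FR_norm G N x =
     Inf {(\<Sum>(h, g, r, e)\<leftarrow>cs. \<bar>r\<bar> * N g) | cs :: ('a rword \<times> 'a \<times> real \<times> int) list.
       (\<forall>(h, g, r, e)\<in>set cs. h \<in> carrier (FR G) \<and> g \<in> carrier G \<and> e \<in> {1, -1}) \<and>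
       x = foldr (\<otimes>\<^bsub>FR G\<^esub>)
             (map (\<lambda>(h, g, r, e).
                h \<otimes>\<^bsub>FR G\<^esub> (letter g r [^]\<^bsub>FR G\<^esub> e) \<otimes>\<^bsub>FR G\<^esub> inv\<^bsub>FR G\<^esub> h) cs)
             \<one>\<^bsub>FR G\<^esub>}"

definition psi :: "('a, 'x) monoid_scheme \<Rightarrow> real \<Rightarrow> 'a rword \<Rightarrow> 'a rword" where
  "psi G t = extend_letters (FR G) (\<lambda>g r. letter g (t * r))"

text \<open>
  The normal form of an element of \<open>F(G)\<close> has integer exponents, so rounding is harmless there
  (the values of \<open>proj\<close> outside \<open>F(G)\<close> are irrelevant).
\<close>

definition proj :: "('a, 'x) monoid_scheme \<Rightarrow> 'a rword \<Rightarrow> 'a" where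
  "proj G = extend_letters G (\<lambda>g r. g [^]\<^bsub>G\<^esub> \<lfloor>r\<rfloor>)"

lemma psi_letter: "g \<in> carrier G \<Longrightarrow> psi G t (letter g r) = letter g (t * r)"
  unfolding psi_def
  by (subst extend_letters_letter) (simp_all add: group_free_real, simp add: letter_def)

lemma psi_hom: "psi G t \<in> hom (FR G) (FR G)"
proof -
  let ?\<phi> = "\<lambda>g r. letter g (t * r)"
  have zero: "?\<phi> g 0 = \<one>\<^bsub>FR G\<^esub>" for g
    by (simp add: letter_def)
  have add: "?\<phi> g (r + s) = ?\<phi> g r \<otimes>\<^bsub>FR G\<^esub> ?\<phi> g s" for g r s
    by (simp add: letter_mult distrib_left)
  note * = extend_letters_mult[OF group_free_real[of "carrier G"], of UNIV "carrier G" ?\<phi>,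
      OF _ _ zero add]
  show ?thesis
    using *(1) *(3)[where v = "[]"] by (auto intro!: homI simp: psi_def mult_free_real)
qed

lemma FZ_exponents:
  assumes "w \<in> carrier (FZ G)"
  shows "w \<in> rwords (carrier G) \<and> snd ` set w \<subseteq> \<int>"
proof -
  interpret FR: group "FR G"
    by (rule group_free_real)
  let ?\<phi> = "\<lambda>(g :: 'a) (r :: real). \<one>\<^bsub>FR G\<^esub>"
  have mult: "snd ` set (u \<otimes>\<^bsub>FR G\<^esub> v) \<subseteq> \<int>"
    if "u \<in> rwords (carrier G)" "snd ` set u \<subseteq> \<int>" "v \<in> rwords (carrier G)" "snd ` set v \<subseteq> \<int>"
    for u v
    using extend_letters_mult(2)[OF FR.is_group, of \<int> "carrier G" ?\<phi> u v] that
    by (auto simp: mult_free_real)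
  have inv_letter: "inv\<^bsub>FR G\<^esub> (letter g 1) = letter g (- 1)" if "g \<in> carrier G" for g
    using that by (intro FR.inv_equality) (auto simp: letter_mult, simp add: letter_def)
  have "w \<in> generate (FR G) ((\<lambda>g. letter g 1) ` carrier G)"
    using assms by (simp add: FZ_def)
  then show ?thesis
  proof induction
    case (inv h)
    then show ?case
      by (auto simp: inv_letter) (auto simp: letter_def)
  next
    case (eng u v)
    then show ?case
      using mult[of u v] FR.m_closed[of u v] by simp
  qed (auto simp: letter_def rwords_Cons)
qed

lemma proj_letter: "group G \<Longrightarrow> g \<in> carrier G \<Longrightarrow> proj G (letter g 1) = g"
  unfolding proj_def
  by (subst extend_letters_letter)
     (simp_all add: group.int_pow_closed group.int_pow_1)

lemma proj_hom:
  assumes "group G"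
  shows "proj G \<in> hom (FZ G) G"
proof -
  interpret group G by fact
  let ?\<phi> = "\<lambda>g r. g [^]\<^bsub>G\<^esub> \<lfloor>r :: real\<rfloor>"
  have add: "?\<phi> g (r + s) = ?\<phi> g r \<otimes>\<^bsub>G\<^esub> ?\<phi> g s"
    if "g \<in> carrier G" "r \<in> \<int>" "s \<in> \<int>" for g r s
    using that by (auto elim!: Ints_cases simp: int_pow_mult simp flip: of_int_add)
  note * = extend_letters_mult[OF assms, of \<int> "carrier G" ?\<phi>, OF _ _ _ add]
  show ?thesis
    using *(1) *(3)[where v = "[]"] FZ_exponents[of _ G]
    by (auto intro!: homI simp: proj_def mult_free_real FZ_def)
qed


section \<open>The directional asymptotic cone\<close>

definition scaling_set :: "real set \<Rightarrow> bool" where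
  "scaling_set T \<longleftrightarrow> T \<subseteq> {0<..} \<and> \<not> bdd_above T"

definition cauchy_along :: "real set \<Rightarrow> ('b \<Rightarrow> 'b \<Rightarrow> real) \<Rightarrow> (real \<Rightarrow> 'b) \<Rightarrow> bool" where
  "cauchy_along T d f \<longleftrightarrow>
     (\<forall>\<epsilon>>0. \<exists>K. \<forall>t\<in>T. \<forall>t'\<in>T. t \<ge> K \<longrightarrow> t' \<ge> K \<longrightarrow> d (f t) (f t') < \<epsilon>)"

text \<open>
  Functions on \<open>T\<close> are extensional (\<open>undefined\<close> off \<open>T\<close>), as in \<open>product_group\<close>.
\<close>

definition D_set ::
  "('a, 'x) monoid_scheme \<Rightarrow> ('a \<Rightarrow> real) \<Rightarrow> real set \<Rightarrow> (real \<Rightarrow> 'a rword) set" where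
  "D_set G N T = {w \<in> carrier (product_group T (\<lambda>_. FZ G)).
     cauchy_along T (group_dist (FR G) (FR_norm G N)) (\<lambda>t. psi G (1 / t) (w t))}"

definition D_norm ::
  "('a, 'x) monoid_scheme \<Rightarrow> ('a \<Rightarrow> real) \<Rightarrow> real set \<Rightarrow> (real \<Rightarrow> 'a rword) \<Rightarrow> real" where
  "D_norm G N T w = Lim (inf at_top (principal T)) (\<lambda>t. FR_norm G N (psi G (1 / t) (w t)))"

definition C_group ::
  "('a, 'x) monoid_scheme \<Rightarrow> ('a \<Rightarrow> real) \<Rightarrow> real set \<Rightarrow> (real \<Rightarrow> 'a) monoid" where
  "C_group G N T = (product_group T (\<lambda>_. G))\<lparr>carrier := compose T (proj G) ` D_set G N T\<rparr>"

definition C_norm ::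
  "('a, 'x) monoid_scheme \<Rightarrow> ('a \<Rightarrow> real) \<Rightarrow> real set \<Rightarrow> (real \<Rightarrow> 'a) \<Rightarrow> real" where
  "C_norm G N T g = Inf {D_norm G N T w | w. w \<in> D_set G N T \<and> compose T (proj G) w = g}"

definition C_null ::
  "('a, 'x) monoid_scheme \<Rightarrow> ('a \<Rightarrow> real) \<Rightarrow> real set \<Rightarrow> (real \<Rightarrow> 'a) set" where
  "C_null G N T = {g \<in> carrier (C_group G N T). C_norm G N T g = 0}"

definition cone ::
  "('a, 'x) monoid_scheme \<Rightarrow> ('a \<Rightarrow> real) \<Rightarrow> real set \<Rightarrow> (real \<Rightarrow> 'a) set monoid" where
  "cone G N T = C_group G N T Mod C_null G N T"

definition cone_class ::
  "('a, 'x) monoid_scheme \<Rightarrow> ('a \<Rightarrow> real) \<Rightarrow> real set \<Rightarrow> (real \<Rightarrow> 'a) \<Rightarrow> (real \<Rightarrow> 'a) set" where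
  "cone_class G N T g = C_null G N T #>\<^bsub>C_group G N T\<^esub> g"

text \<open>The common value of the pseudonorm on a coset.\<close>

definition cone_norm ::
  "('a, 'x) monoid_scheme \<Rightarrow> ('a \<Rightarrow> real) \<Rightarrow> real set \<Rightarrow> (real \<Rightarrow> 'a) set \<Rightarrow> real" where
  "cone_norm G N T X = the_elem (C_norm G N T ` X)"

text \<open>
  The map \<open>[g] \<mapsto> [\<phi> \<circ> g]\<close> between cones induced by a map \<open>\<phi>\<close>, not necessarily a homomorphism.
  It is meaningful only if \<open>\<phi> \<circ> g\<close> lies in \<open>C_group H M T\<close> and its class depends only on that
  of \<open>g\<close>.
\<close>

definition cone_map ::
  "('a, 'x) monoid_scheme \<Rightarrow> ('a \<Rightarrow> real) \<Rightarrow> ('b, 'y) monoid_scheme \<Rightarrow> ('b \<Rightarrow> real) \<Rightarrow> real set \<Rightarrow>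
     ('a \<Rightarrow> 'b) \<Rightarrow> (real \<Rightarrow> 'a) set \<Rightarrow> (real \<Rightarrow> 'b) set" where
  "cone_map G N H M T \<phi> X = the_elem ((\<lambda>g. cone_class H M T (compose T \<phi> g)) ` X)"

definition cone_map_well_defined ::
  "('a, 'x) monoid_scheme \<Rightarrow> ('a \<Rightarrow> real) \<Rightarrow> ('b, 'y) monoid_scheme \<Rightarrow> ('b \<Rightarrow> real) \<Rightarrow> real set \<Rightarrow>
     ('a \<Rightarrow> 'b) \<Rightarrow> bool" where
  "cone_map_well_defined G N H M T \<phi> \<longleftrightarrow>
     (\<forall>g\<in>carrier (C_group G N T).
        compose T \<phi> g \<in> carrier (C_group H M T) \<and>
        cone_map G N H M T \<phi> (cone_class G N T g) = cone_class H M T (compose T \<phi> g))"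

end

theory Submission
  imports Defs
begin

text \<open>
  The point is that the cone does not see bounded perturbations.  If \<open>k : T \<rightarrow> G\<close> has bounded
  norm, it lifts to the letters \<open>w(t) = k(t)\<close> of \<open>F(G)\<close>, and scaling by \<open>1/t\<close> brings the norm
  of \<open>w(t)\<close> below a constant multiple of \<open>1/t\<close>.  So \<open>w\<close> is Cauchy with limit norm \<open>0\<close>, and
  \<open>k\<close> represents the trivial class (\<open>bounded_mem_C_null\<close>).  Consequently two functions that
  agree modulo a bounded kernel have the same class, and if one of them belongs to
  \<open>\<C>(G,T)\<close>, so does the other (\<open>cls_eq_mod_bounded\<close>).

  Any map \<open>\<phi> : G \<rightarrow> H\<close> with \<open>\<parallel>\<phi>(g)\<parallel> \<le> C \<parallel>g\<parallel>\<close>, homomorphism or not, acts on the indices of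
  the free product and so induces a homomorphism \<open>relabel H \<phi>\<close> from \<open>F\<^sub>\<real>(G)\<close> to \<open>F\<^sub>\<real>(H)\<close>.  It is
  Lipschitz with constant \<open>C\<close> and commutes with scaling, so it maps Cauchy lifts to Cauchy lifts.
  If moreover \<open>q \<circ> \<phi>\<close> is a homomorphism for some homomorphism \<open>q\<close> on \<open>H\<close> with bounded
  kernel, then projecting the relabelled lift of \<open>g\<close> to \<open>H\<close> gives \<open>\<phi> \<circ> g\<close> up to this kernel.
  Hence \<open>\<phi> \<circ> g\<close> is again in the cone group, its norm is at most \<open>C\<close> times that of \<open>g\<close>, and,
  as \<open>\<phi>\<close> is multiplicative modulo the kernel of \<open>q\<close>, the induced map of cones is a
  well-defined homomorphism, Lipschitz with constant \<open>C\<close> (locale \<open>coarse_hom\<close>).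

  This applies to \<open>f\<close> with \<open>q\<close> the identity, and to the section \<open>s\<close> with \<open>q = f\<close>.  The two
  induced maps are mutually inverse: \<open>f \<circ> s\<close> is the identity, and \<open>s \<circ> f\<close> is the identity
  modulo the bounded kernel of \<open>f\<close>.
\<close>

section \<open>Groups with a conjugation-invariant pseudonorm\<close>

lemma (in group) mult_inv_cancel:
  assumes "x \<in> carrier G" "y \<in> carrier G"
  shows "inv x \<otimes> (x \<otimes> y) = y" and "x \<otimes> (inv x \<otimes> y) = y"
  using assms by (simp_all add: m_assoc[symmetric])

locale pseudonormed_group = group G for G (structure) and N :: "'a \<Rightarrow> real" +
  assumes nonneg: "x \<in> carrier G \<Longrightarrow> 0 \<le> N x"
    and norm_one: "N \<one> = 0"
    and norm_inv: "x \<in> carrier G \<Longrightarrow> N (inv x) = N x"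
    and triangle: "x \<in> carrier G \<Longrightarrow> y \<in> carrier G \<Longrightarrow> N (x \<otimes> y) \<le> N x + N y"
    and norm_conj: "x \<in> carrier G \<Longrightarrow> h \<in> carrier G \<Longrightarrow> N (h \<otimes> x \<otimes> inv h) = N x"
begin

lemma norm_conj': "x \<in> carrier G \<Longrightarrow> h \<in> carrier G \<Longrightarrow> N (inv h \<otimes> x \<otimes> h) = N x"
  using norm_conj[of x "inv h"] by simp

lemma dist_mult:
  assumes "x \<in> carrier G" "x' \<in> carrier G" "y \<in> carrier G" "y' \<in> carrier G"
  shows "group_dist G N (x \<otimes> y) (x' \<otimes> y') \<le> group_dist G N x x' + group_dist G N y y'"
proof -
  have "inv (x \<otimes> y) \<otimes> (x' \<otimes> y') = inv y \<otimes> (inv x \<otimes> x') \<otimes> y \<otimes> (inv y \<otimes> y')"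
    using assms by (simp add: inv_mult_group m_assoc mult_inv_cancel)
  then show ?thesis
    using assms triangle[of "inv y \<otimes> (inv x \<otimes> x') \<otimes> y" "inv y \<otimes> y'"]
    by (simp add: group_dist_def norm_conj')
qed

lemma dist_inv:
  assumes "x \<in> carrier G" "y \<in> carrier G"
  shows "group_dist G N (inv x) (inv y) = group_dist G N x y"
proof -
  have "N (x \<otimes> inv y) = N (inv x \<otimes> (x \<otimes> inv y) \<otimes> x)"
    using assms by (simp add: norm_conj')
  also have "inv x \<otimes> (x \<otimes> inv y) \<otimes> x = inv (inv x \<otimes> y)"
    using assms by (simp add: m_assoc[symmetric] inv_mult_group)
  also have "N \<dots> = N (inv x \<otimes> y)"
    using assms by (simp add: norm_inv)
  finally show ?thesis
    using assms by (simp add: group_dist_def)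
qed

lemma norm_diff_le_dist:
  assumes "x \<in> carrier G" "y \<in> carrier G"
  shows "\<bar>N x - N y\<bar> \<le> group_dist G N x y"
proof -
  have xy: "x \<otimes> (inv x \<otimes> y) = y" and yx: "y \<otimes> inv (inv x \<otimes> y) = x"
    using assms by (simp_all add: m_assoc[symmetric] inv_mult_group)
  have "N y \<le> N x + N (inv x \<otimes> y)"
    using triangle[of x "inv x \<otimes> y"] xy assms by simp
  moreover have "N x \<le> N y + N (inv x \<otimes> y)"
    using triangle[of y "inv (inv x \<otimes> y)"] yx assms norm_inv[of "inv x \<otimes> y"] by simp
  ultimately show ?thesis
    by (simp add: group_dist_def)
qed

lemma normal_null: "normal {x \<in> carrier G. N x = 0} G"
  unfolding normal_inv_iff
proof (intro conjI ballI subgroupI)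
  fix x y assume "x \<in> {x \<in> carrier G. N x = 0}" "y \<in> {x \<in> carrier G. N x = 0}"
  then show "x \<otimes> y \<in> {x \<in> carrier G. N x = 0}"
    using triangle[of x y] nonneg[of "x \<otimes> y"] by auto
qed (use norm_one in \<open>auto simp: norm_inv norm_conj\<close>)

lemma norm_mult_null:
  assumes "x \<in> carrier G" "y \<in> carrier G" "N x = 0"
  shows "N (x \<otimes> y) = N y"
proof -
  have "inv x \<otimes> (x \<otimes> y) = y"
    using assms by (simp add: m_assoc[symmetric])
  then show ?thesis
    using assms triangle[of x y] triangle[of "inv x" "x \<otimes> y"] norm_inv[of x] by simp
qed

end

lemma pseudonormed_groupI:
  assumes "group G" "group_norm G N" "conj_invariant G N"
  shows "pseudonormed_group G N"
proof -
  interpret group G by fact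
  show ?thesis
    using assms(2,3) by unfold_locales (auto simp: group_norm_def conj_invariant_def)
qed

text \<open>
  Lifts combine to lifts of products, inverses and conjugates, so each law of a pseudonorm passes
  to the infimum over the fibres.
\<close>

lemma pseudonormed_group_quotient:
  assumes D: "pseudonormed_group D M" and C: "group C" and p: "p \<in> hom D C"
    and surj: "p ` carrier D = carrier C"
  shows "pseudonormed_group C (\<lambda>g. Inf {M w | w. w \<in> carrier D \<and> p w = g})"
proof -
  interpret D: pseudonormed_group D M by fact
  interpret C: group C by fact
  interpret p: group_hom D C p
    using p by unfold_locales
  define S where "S g = {M w | w. w \<in> carrier D \<and> p w = g}" for g
  have ne: "S g \<noteq> {}" if "g \<in> carrier C" for g
    using that unfolding S_def surj[symmetric] by blast
  have bdd: "bdd_below (S g)" for g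
    by (rule bdd_belowI[of _ 0]) (auto simp: S_def D.nonneg)
  have lower: "Inf (S g) \<le> M w" if "w \<in> carrier D" "p w = g" for w g
    using that by (intro cInf_lower bdd) (auto simp: S_def)
  have greatest: "c \<le> Inf (S g)"
    if "g \<in> carrier C" "\<And>w. w \<in> carrier D \<Longrightarrow> p w = g \<Longrightarrow> c \<le> M w" for c g
    using that by (intro cInf_greatest ne) (auto simp: S_def)
  have "pseudonormed_group C (\<lambda>g. Inf (S g))"
  proof
    show nonneg: "0 \<le> Inf (S x)" if "x \<in> carrier C" for x
      using that by (intro greatest D.nonneg)
    show "Inf (S \<one>\<^bsub>C\<^esub>) = 0"
      using lower[of "\<one>\<^bsub>D\<^esub>" "\<one>\<^bsub>C\<^esub>"] nonneg[of "\<one>\<^bsub>C\<^esub>"] D.norm_one by simp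
    have inv_le: "Inf (S (inv\<^bsub>C\<^esub> x)) \<le> Inf (S x)" if "x \<in> carrier C" for x
    proof (rule greatest)
      fix w assume "w \<in> carrier D" "p w = x"
      then show "Inf (S (inv\<^bsub>C\<^esub> x)) \<le> M w"
        using lower[of "inv\<^bsub>D\<^esub> w" "inv\<^bsub>C\<^esub> x"] by (simp add: D.norm_inv)
    qed (use that in auto)
    show "Inf (S (inv\<^bsub>C\<^esub> x)) = Inf (S x)" if "x \<in> carrier C" for x
      using inv_le[of x] inv_le[of "inv\<^bsub>C\<^esub> x"] that by simp
    show "Inf (S (x \<otimes>\<^bsub>C\<^esub> y)) \<le> Inf (S x) + Inf (S y)" if xy: "x \<in> carrier C" "y \<in> carrier C" for x y
    proof -
      have "Inf (S (x \<otimes>\<^bsub>C\<^esub> y)) - M v \<le> Inf (S x)" if v: "v \<in> carrier D" "p v = y" for v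
      proof (rule greatest)
        fix w assume "w \<in> carrier D" "p w = x"
        then show "Inf (S (x \<otimes>\<^bsub>C\<^esub> y)) - M v \<le> M w"
          using v lower[of "w \<otimes>\<^bsub>D\<^esub> v" "x \<otimes>\<^bsub>C\<^esub> y"] D.triangle[of w v] by simp
      qed (use xy in auto)
      then have "Inf (S (x \<otimes>\<^bsub>C\<^esub> y)) - Inf (S x) \<le> Inf (S y)"
        using xy by (intro greatest) (auto simp: algebra_simps)
      then show ?thesis
        by simp
    qed
    have conj_le: "Inf (S (h \<otimes>\<^bsub>C\<^esub> x \<otimes>\<^bsub>C\<^esub> inv\<^bsub>C\<^esub> h)) \<le> Inf (S x)"
      if x: "x \<in> carrier C" and h: "h \<in> carrier C" for x h
    proof (rule greatest)
      fix w assume w: "w \<in> carrier D" "p w = x"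
      obtain v where v: "v \<in> carrier D" "p v = h"
        using h unfolding surj[symmetric] by blast
      show "Inf (S (h \<otimes>\<^bsub>C\<^esub> x \<otimes>\<^bsub>C\<^esub> inv\<^bsub>C\<^esub> h)) \<le> M w"
        using w v lower[of "v \<otimes>\<^bsub>D\<^esub> w \<otimes>\<^bsub>D\<^esub> inv\<^bsub>D\<^esub> v" "h \<otimes>\<^bsub>C\<^esub> x \<otimes>\<^bsub>C\<^esub> inv\<^bsub>C\<^esub> h"]
        by (simp add: D.norm_conj)
    qed (use that in auto)
    show "Inf (S (h \<otimes>\<^bsub>C\<^esub> x \<otimes>\<^bsub>C\<^esub> inv\<^bsub>C\<^esub> h)) = Inf (S x)"
      if x: "x \<in> carrier C" and h: "h \<in> carrier C" for x h
    proof (rule antisym)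
      have "inv\<^bsub>C\<^esub> h \<otimes>\<^bsub>C\<^esub> (h \<otimes>\<^bsub>C\<^esub> x \<otimes>\<^bsub>C\<^esub> inv\<^bsub>C\<^esub> h) \<otimes>\<^bsub>C\<^esub> inv\<^bsub>C\<^esub> (inv\<^bsub>C\<^esub> h) = x"
        using x h by (simp add: C.m_assoc C.mult_inv_cancel)
      then show "Inf (S x) \<le> Inf (S (h \<otimes>\<^bsub>C\<^esub> x \<otimes>\<^bsub>C\<^esub> inv\<^bsub>C\<^esub> h))"
        using conj_le[of "h \<otimes>\<^bsub>C\<^esub> x \<otimes>\<^bsub>C\<^esub> inv\<^bsub>C\<^esub> h" "inv\<^bsub>C\<^esub> h"] x h by simp
    qed (use conj_le that in auto)
  qed
  then show ?thesis
    by (simp add: S_def)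
qed


section \<open>The pseudonorm of the free product\<close>

declare carrier_free_real [simp del] one_free_real [simp del]

lemma letter_closed [simp]: "g \<in> A \<Longrightarrow> letter g r \<in> carrier (free_real A)"
  by (simp add: carrier_free_real)

lemma letter_zero: "letter g 0 = \<one>\<^bsub>free_real A\<^esub>"
  by (simp add: letter_def one_free_real)

text \<open>
  The costs of the expressions of an element as a product of conjugates of letters, generated
  factor by factor.  The signs in the definition of \<open>FR_norm\<close> are absorbed into the exponents.
\<close>

inductive expr_cost :: "('a, 'x) monoid_scheme \<Rightarrow> ('a \<Rightarrow> real) \<Rightarrow> 'a rword \<Rightarrow> real \<Rightarrow> bool"
  for G N where
  one: "expr_cost G N \<one>\<^bsub>FR G\<^esub> 0"
| step: "h \<in> carrier (FR G) \<Longrightarrow> g \<in> carrier G \<Longrightarrow> expr_cost G N x c \<Longrightarrow>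
    expr_cost G N ((h \<otimes>\<^bsub>FR G\<^esub> letter g r \<otimes>\<^bsub>FR G\<^esub> inv\<^bsub>FR G\<^esub> h) \<otimes>\<^bsub>FR G\<^esub> x) (\<bar>r\<bar> * N g + c)"

lemma inv_letter:
  assumes "g \<in> carrier G"
  shows "inv\<^bsub>FR G\<^esub> letter g r = letter g (- r)"
proof -
  interpret FR: group "FR G"
    by (rule group_free_real)
  show ?thesis
    using assms by (intro FR.inv_equality) (simp_all add: letter_mult letter_zero)
qed

lemma FR_norm_eq_Inf_cost: "FR_norm G N x = Inf {c. expr_cost G N x c}"
proof -
  interpret FR: group "FR G"
    by (rule group_free_real)
  define ok where
    "ok cs \<longleftrightarrow> (\<forall>(h, g, r, e)\<in>set cs. h \<in> carrier (FR G) \<and> g \<in> carrier G \<and> e \<in> {1, -1})"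
    for cs :: "('a rword \<times> 'a \<times> real \<times> int) list"
  define val where
    "val cs = foldr (\<otimes>\<^bsub>FR G\<^esub>)
             (map (\<lambda>(h, g, r, e).
                h \<otimes>\<^bsub>FR G\<^esub> (letter g r [^]\<^bsub>FR G\<^esub> e) \<otimes>\<^bsub>FR G\<^esub> inv\<^bsub>FR G\<^esub> h) cs)
             \<one>\<^bsub>FR G\<^esub>"
    for cs :: "('a rword \<times> 'a \<times> real \<times> int) list"
  define cost where "cost cs = (\<Sum>(h, g, r, e)\<leftarrow>cs. \<bar>r\<bar> * N g)"
    for cs :: "('a rword \<times> 'a \<times> real \<times> int) list"
  have pow: "letter g r [^]\<^bsub>FR G\<^esub> e = letter g (e * r)"
    if "g \<in> carrier G" "e \<in> {1, -1}" for g and e :: int and r :: real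
    using that by (auto simp: FR.int_pow_1 FR.int_pow_neg inv_letter)
  have "expr_cost G N x c \<longleftrightarrow> (\<exists>cs. ok cs \<and> val cs = x \<and> cost cs = c)" for c
  proof
    assume "expr_cost G N x c"
    then show "\<exists>cs. ok cs \<and> val cs = x \<and> cost cs = c"
    proof induction
      case one
      then show ?case
        by (intro exI[of _ "[]"]) (simp add: ok_def val_def cost_def)
    next
      case (step h g x c r)
      then obtain cs where "ok cs" "val cs = x" "cost cs = c"
        by blast
      then show ?case
        using step.hyps
        by (intro exI[of _ "(h, g, r, 1) # cs"]) (auto simp: ok_def val_def cost_def FR.int_pow_1)
    qed
  next
    assume "\<exists>cs. ok cs \<and> val cs = x \<and> cost cs = c"
    moreover have "expr_cost G N (val cs) (cost cs)" if "ok cs" for cs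
      using that
    proof (induction cs)
      case Nil
      then show ?case
        using expr_cost.one[of G N] by (simp add: val_def cost_def)
    next
      case (Cons q cs)
      obtain h g r e where q: "q = (h, g, r, e)"
        by (cases q)
      have h: "h \<in> carrier (FR G)" and g: "g \<in> carrier G" and e: "e \<in> {1, -1}" and cs: "ok cs"
        using Cons.prems by (auto simp: ok_def q)
      have "\<bar>real_of_int e * r\<bar> = \<bar>r\<bar>"
        using e by auto
      then show ?case
        using expr_cost.step[OF h g Cons.IH[OF cs], of "e * r"] pow[OF g e]
        by (simp add: q val_def cost_def)
    qed
    ultimately show "expr_cost G N x c"
      by blast
  qed
  then have "{c. expr_cost G N x c} = {cost cs | cs. ok cs \<and> x = val cs}"
    by auto
  then show ?thesis
    by (simp only: FR_norm_def ok_def val_def cost_def)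
qed

text \<open>
  A normal form is the product of its letters, so properties stable under left multiplication by
  letters hold throughout the free product.
\<close>

lemma rword_induct [consumes 1, case_names one letter_mult]:
  assumes "w \<in> carrier (free_real A)" and "P \<one>\<^bsub>free_real A\<^esub>"
    and "\<And>a r w. a \<in> A \<Longrightarrow> w \<in> carrier (free_real A) \<Longrightarrow> P w \<Longrightarrow>
      P (letter a r \<otimes>\<^bsub>free_real A\<^esub> w)"
  shows "P w"
  using assms(1)
proof (induction w)
  case Nil
  then show ?case
    using assms(2) by (simp add: one_free_real)
next
  case (Cons p w)
  obtain a r where p: "p = (a, r)"
    by (cases p)
  then show ?case
    using Cons assms(3)[of a w r] push_Cons_eq[of a r w A]
    by (auto simp: mult_free_real letter_def rwords_Cons carrier_free_real)
qed

context
  fixes G :: "('a, 'x) monoid_scheme" and N :: "'a \<Rightarrow> real"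
begin

interpretation FR: group "FR G"
  by (rule group_free_real)

lemma expr_cost_closed: "expr_cost G N x c \<Longrightarrow> x \<in> carrier (FR G)"
  by (induction rule: expr_cost.induct) auto

lemma expr_cost_letter:
  assumes "g \<in> carrier G"
  shows "expr_cost G N (letter g r) (\<bar>r\<bar> * N g)"
  using expr_cost.step[OF FR.one_closed assms expr_cost.one, of N r] assms by simp

lemma expr_cost_mult:
  assumes "expr_cost G N x c" "expr_cost G N y d"
  shows "expr_cost G N (x \<otimes>\<^bsub>FR G\<^esub> y) (c + d)"
  using assms
proof induction
  case one
  then show ?case
    by (simp add: expr_cost_closed)
next
  case (step h g x c r)
  then show ?case
    using expr_cost.step[of h G g N "x \<otimes>\<^bsub>FR G\<^esub> y" "c + d" r] expr_cost_closed
    by (simp add: FR.m_assoc add.assoc)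
qed

lemma expr_cost_conj:
  assumes "expr_cost G N x c" "k \<in> carrier (FR G)"
  shows "expr_cost G N (k \<otimes>\<^bsub>FR G\<^esub> x \<otimes>\<^bsub>FR G\<^esub> inv\<^bsub>FR G\<^esub> k) c"
  using assms(1)
proof induction
  case one
  then show ?case
    using expr_cost.one[of G N] assms(2) by simp
next
  case (step h g x c r)
  have x: "x \<in> carrier (FR G)"
    using step expr_cost_closed by blast
  let ?k = "k \<otimes>\<^bsub>FR G\<^esub> h"
  have "k \<otimes>\<^bsub>FR G\<^esub> ((h \<otimes>\<^bsub>FR G\<^esub> letter g r \<otimes>\<^bsub>FR G\<^esub> inv\<^bsub>FR G\<^esub> h) \<otimes>\<^bsub>FR G\<^esub> x) \<otimes>\<^bsub>FR G\<^esub> inv\<^bsub>FR G\<^esub> k =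
    (?k \<otimes>\<^bsub>FR G\<^esub> letter g r \<otimes>\<^bsub>FR G\<^esub> inv\<^bsub>FR G\<^esub> ?k) \<otimes>\<^bsub>FR G\<^esub> (k \<otimes>\<^bsub>FR G\<^esub> x \<otimes>\<^bsub>FR G\<^esub> inv\<^bsub>FR G\<^esub> k)"
    using step.hyps assms(2) x by (simp add: FR.m_assoc FR.inv_mult_group FR.mult_inv_cancel)
  then show ?case
    using step expr_cost.step[OF _ _ step.IH, of ?k g r] assms(2) by simp
qed

lemma expr_cost_inv:
  assumes "expr_cost G N x c"
  shows "expr_cost G N (inv\<^bsub>FR G\<^esub> x) c"
  using assms
proof induction
  case one
  then show ?case
    using expr_cost.one[of G N] by simp
next
  case (step h g x c r)
  have x: "x \<in> carrier (FR G)"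
    using step expr_cost_closed by blast
  have "expr_cost G N (inv\<^bsub>FR G\<^esub> x \<otimes>\<^bsub>FR G\<^esub>
      (h \<otimes>\<^bsub>FR G\<^esub> letter g (- r) \<otimes>\<^bsub>FR G\<^esub> inv\<^bsub>FR G\<^esub> h)) (c + \<bar>- r\<bar> * N g)"
    using step by (intro expr_cost_mult expr_cost_conj expr_cost_letter)
  then show ?case
    using step.hyps x by (simp add: FR.inv_mult_group FR.m_assoc inv_letter add.commute)
qed

lemma expr_cost_exists: "x \<in> carrier (FR G) \<Longrightarrow> \<exists>c. expr_cost G N x c"
proof (induction rule: rword_induct)
  case one
  then show ?case
    using expr_cost.one by blast
next
  case (letter_mult a r w)
  then show ?case
    using expr_cost_mult expr_cost_letter by blast
qed

end

context
  fixes G :: "('a, 'x) monoid_scheme" and N :: "'a \<Rightarrow> real"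
  assumes N_nonneg: "\<And>g. g \<in> carrier G \<Longrightarrow> 0 \<le> N g"
begin

interpretation FR: group "FR G"
  by (rule group_free_real)

lemma expr_cost_nonneg: "expr_cost G N x c \<Longrightarrow> 0 \<le> c"
  by (induction rule: expr_cost.induct) (auto simp: N_nonneg)

lemma FR_norm_le: "expr_cost G N x c \<Longrightarrow> FR_norm G N x \<le> c"
  unfolding FR_norm_eq_Inf_cost
  by (intro cInf_lower bdd_belowI[of _ 0]) (auto intro: expr_cost_nonneg)

lemma FR_norm_greatest:
  assumes "x \<in> carrier (FR G)" "\<And>c. expr_cost G N x c \<Longrightarrow> b \<le> c"
  shows "b \<le> FR_norm G N x"
  unfolding FR_norm_eq_Inf_cost
  using assms expr_cost_exists[OF assms(1)] by (intro cInf_greatest) auto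

lemma FR_norm_letter_le: "g \<in> carrier G \<Longrightarrow> FR_norm G N (letter g r) \<le> \<bar>r\<bar> * N g"
  by (intro FR_norm_le expr_cost_letter)

lemma pseudonormed_FR: "pseudonormed_group (FR G) (FR_norm G N)"
proof
  show nonneg: "0 \<le> FR_norm G N x" if "x \<in> carrier (FR G)" for x
    using that by (intro FR_norm_greatest expr_cost_nonneg)
  show "FR_norm G N \<one>\<^bsub>FR G\<^esub> = 0"
    using nonneg[of "\<one>\<^bsub>FR G\<^esub>"] FR_norm_le[OF expr_cost.one] by simp
  have inv_le: "FR_norm G N (inv\<^bsub>FR G\<^esub> x) \<le> FR_norm G N x" if "x \<in> carrier (FR G)" for x
    using that by (intro FR_norm_greatest FR_norm_le expr_cost_inv)
  show "FR_norm G N (inv\<^bsub>FR G\<^esub> x) = FR_norm G N x" if "x \<in> carrier (FR G)" for x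
    using inv_le[of x] inv_le[of "inv\<^bsub>FR G\<^esub> x"] that by simp
  show "FR_norm G N (x \<otimes>\<^bsub>FR G\<^esub> y) \<le> FR_norm G N x + FR_norm G N y"
    if "x \<in> carrier (FR G)" "y \<in> carrier (FR G)" for x y
  proof -
    have "FR_norm G N (x \<otimes>\<^bsub>FR G\<^esub> y) - d \<le> FR_norm G N x" if "expr_cost G N y d" for d
      using that \<open>x \<in> carrier (FR G)\<close>
      by (intro FR_norm_greatest) (auto simp: diff_le_eq intro: FR_norm_le expr_cost_mult)
    then have "FR_norm G N (x \<otimes>\<^bsub>FR G\<^esub> y) - FR_norm G N x \<le> FR_norm G N y"
      using that(2) by (intro FR_norm_greatest) (auto simp: algebra_simps)
    then show ?thesis
      by simp
  qed
  have conj_le: "FR_norm G N (h \<otimes>\<^bsub>FR G\<^esub> x \<otimes>\<^bsub>FR G\<^esub> inv\<^bsub>FR G\<^esub> h) \<le> FR_norm G N x"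
    if "x \<in> carrier (FR G)" "h \<in> carrier (FR G)" for x h
    using that by (intro FR_norm_greatest FR_norm_le expr_cost_conj)
  show "FR_norm G N (h \<otimes>\<^bsub>FR G\<^esub> x \<otimes>\<^bsub>FR G\<^esub> inv\<^bsub>FR G\<^esub> h) = FR_norm G N x"
    if x: "x \<in> carrier (FR G)" and h: "h \<in> carrier (FR G)" for x h
  proof (rule antisym)
    let ?y = "h \<otimes>\<^bsub>FR G\<^esub> x \<otimes>\<^bsub>FR G\<^esub> inv\<^bsub>FR G\<^esub> h"
    have "inv\<^bsub>FR G\<^esub> h \<otimes>\<^bsub>FR G\<^esub> ?y \<otimes>\<^bsub>FR G\<^esub> inv\<^bsub>FR G\<^esub> (inv\<^bsub>FR G\<^esub> h) = x"
      using x h by (simp add: FR.m_assoc FR.mult_inv_cancel)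
    then show "FR_norm G N x \<le> FR_norm G N ?y"
      using conj_le[of ?y "inv\<^bsub>FR G\<^esub> h"] x h by simp
  qed (use conj_le that in auto)
qed

end

section \<open>Limits along a scaling set\<close>

abbreviation along :: "real set \<Rightarrow> real filter" where
  "along T \<equiv> inf at_top (principal T)"

lemma eventually_along: "eventually P (along T) \<longleftrightarrow> (\<exists>K. \<forall>t\<in>T. t \<ge> K \<longrightarrow> P t)"
  unfolding eventually_inf_principal eventually_at_top_linorder by blast

lemma along_nontrivial:
  assumes "scaling_set T"
  shows "along T \<noteq> bot"
proof
  assume "along T = bot"
  then have "eventually (\<lambda>t. False) (along T)"
    by simp
  then obtain K where "\<forall>t\<in>T. \<not> t \<ge> K"
    unfolding eventually_along by auto
  then have "bdd_above T"
    by (intro bdd_aboveI[of _ K]) auto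
  then show False
    using assms by (simp add: scaling_set_def)
qed

lemma cauchy_along_D:
  assumes "cauchy_along T d f" "0 < e"
  obtains K where "\<And>t t'. t \<in> T \<Longrightarrow> t' \<in> T \<Longrightarrow> t \<ge> K \<Longrightarrow> t' \<ge> K \<Longrightarrow> d (f t) (f t') < e"
  using assms unfolding cauchy_along_def by meson

text \<open>
  As \<open>T\<close> is unbounded, it contains a sequence tending to infinity; the limit of \<open>f\<close> along it
  is the limit along all of \<open>T\<close>.
\<close>

lemma cauchy_along_real_convergent:
  fixes f :: "real \<Rightarrow> real"
  assumes T: "scaling_set T" and f: "cauchy_along T dist f"
  obtains L where "(f \<longlongrightarrow> L) (along T)"
proof -
  have "\<exists>t\<in>T. real n \<le> t" for n
  proof (rule ccontr)
    assume "\<not> ?thesis"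
    then have "bdd_above T"
      by (intro bdd_aboveI[of _ "real n"]) auto
    then show False
      using T by (simp add: scaling_set_def)
  qed
  then obtain s where s: "\<And>n. s n \<in> T" "\<And>n. real n \<le> s n"
    by metis
  have s_ge: "K \<le> s n" if "nat \<lceil>K\<rceil> \<le> n" for K n
    using that s(2)[of n] by linarith
  have "Cauchy (\<lambda>n. f (s n))"
  proof (rule metric_CauchyI)
    fix e :: real assume "0 < e"
    then obtain K where "\<And>t t'. t \<in> T \<Longrightarrow> t' \<in> T \<Longrightarrow> t \<ge> K \<Longrightarrow> t' \<ge> K \<Longrightarrow> dist (f t) (f t') < e"
      using cauchy_along_D[OF f] by blast
    then show "\<exists>M. \<forall>m\<ge>M. \<forall>n\<ge>M. dist (f (s m)) (f (s n)) < e"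
      using s(1) s_ge by blast
  qed
  then obtain L where L: "(\<lambda>n. f (s n)) \<longlonglongrightarrow> L"
    using Cauchy_convergent_iff convergent_def by blast
  have "(f \<longlongrightarrow> L) (along T)"
  proof (rule tendstoI)
    fix e :: real assume "0 < e"
    then obtain K where K: "\<And>t t'. t \<in> T \<Longrightarrow> t' \<in> T \<Longrightarrow> t \<ge> K \<Longrightarrow> t' \<ge> K \<Longrightarrow>
        dist (f t) (f t') < e / 2"
      using cauchy_along_D[OF f, of "e / 2"] by auto
    obtain m where m: "\<And>n. n \<ge> m \<Longrightarrow> dist (f (s n)) L < e / 2"
      using metric_LIMSEQ_D[OF L, of "e / 2"] \<open>0 < e\<close> by auto
    have "dist (f t) L < e" if "t \<in> T" "t \<ge> K" for t
    proof -
      let ?n = "max m (nat \<lceil>K\<rceil>)"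
      have "dist (f t) (f (s ?n)) < e / 2" "dist (f (s ?n)) L < e / 2"
        using that s(1) s_ge[of K ?n] by (simp_all del: less_divide_eq_numeral1 add: K m)
      then show ?thesis
        using dist_triangle[of "f t" L "f (s ?n)"] by linarith
    qed
    then show "eventually (\<lambda>t. dist (f t) L < e) (along T)"
      by (auto simp: eventually_along)
  qed
  then show ?thesis
    using that by blast
qed


section \<open>The groups of which the cone is a quotient\<close>

lemma FZ_simps [simp]:
  "(\<otimes>\<^bsub>FZ G\<^esub>) = (\<otimes>\<^bsub>FR G\<^esub>)" "\<one>\<^bsub>FZ G\<^esub> = \<one>\<^bsub>FR G\<^esub>"
  by (simp_all add: FZ_def)

lemma subgroup_FZ: "subgroup (carrier (FZ G)) (FR G)"
  by (simp add: FZ_def group.generate_is_subgroup[OF group_free_real] image_subset_iff)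

lemma group_FZ [simp]: "group (FZ G)"
  using group.subgroup_imp_group[OF group_free_real subgroup_FZ, of G] by (simp add: FZ_def)

lemma FZ_closed: "w \<in> carrier (FZ G) \<Longrightarrow> w \<in> carrier (FR G)"
  using subgroup.mem_carrier[OF subgroup_FZ] .

lemma inv_FZ [simp]: "w \<in> carrier (FZ G) \<Longrightarrow> inv\<^bsub>FZ G\<^esub> w = inv\<^bsub>FR G\<^esub> w"
  using group.m_inv_consistent[OF group_free_real subgroup_FZ, of w G] by (simp add: FZ_def)

lemma letter_FZ: "g \<in> carrier G \<Longrightarrow> letter g 1 \<in> carrier (FZ G)"
  by (auto simp: FZ_def intro: generate.incl)

locale cone_setup = pseudonormed_group G N for G (structure) and N +
  fixes T :: "real set"
  assumes scaling: "scaling_set T"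
begin

sublocale FR: pseudonormed_group "FR G" "FR_norm G N"
  by (intro pseudonormed_FR nonneg)

sublocale psi: group_hom "FR G" "FR G" "psi G r" for r
  by unfold_locales (rule psi_hom)

lemma T_pos: "t \<in> T \<Longrightarrow> 0 < t"
  using scaling by (auto simp: scaling_set_def)

abbreviation "scaled w \<equiv> (\<lambda>t. psi G (1 / t) (w t))"

abbreviation FRdist where "FRdist \<equiv> group_dist (FR G) (FR_norm G N)"

abbreviation "D_ambient \<equiv> product_group T (\<lambda>_. FZ G)"

definition "D_group = D_ambient\<lparr>carrier := D_set G N T\<rparr>"

lemma D_ambient_closed: "w \<in> carrier D_ambient \<Longrightarrow> t \<in> T \<Longrightarrow> w t \<in> carrier (FR G)"
  using FZ_closed by (auto simp: PiE_iff)

lemma D_set_iff: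
  "w \<in> D_set G N T \<longleftrightarrow> w \<in> carrier D_ambient \<and> cauchy_along T FRdist (scaled w)"
  by (auto simp: D_set_def)

lemma D_closed: "w \<in> D_set G N T \<Longrightarrow> t \<in> T \<Longrightarrow> w t \<in> carrier (FR G)"
  using D_ambient_closed by (simp add: D_set_iff)

lemma D_ambient_mult:
  "t \<in> T \<Longrightarrow> (u \<otimes>\<^bsub>D_ambient\<^esub> v) t = u t \<otimes>\<^bsub>FR G\<^esub> v t"
  by simp

lemma D_ambient_inv:
  "w \<in> carrier D_ambient \<Longrightarrow> t \<in> T \<Longrightarrow> (inv\<^bsub>D_ambient\<^esub> w) t = inv\<^bsub>FR G\<^esub> (w t)"
  by (subst inv_product_group) (auto simp: PiE_iff)

lemma D_ambient_group: "group D_ambient"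
  by simp

text \<open>
  The metric is bi-invariant, so products and inverses of Cauchy functions are Cauchy.
\<close>

lemma subgroup_D_set: "subgroup (D_set G N T) D_ambient"
proof
  interpret D: group D_ambient
    by simp
  show "D_set G N T \<subseteq> carrier D_ambient"
    by (auto simp: D_set_def)
  show "\<one>\<^bsub>D_ambient\<^esub> \<in> D_set G N T"
  proof -
    have "FRdist (scaled \<one>\<^bsub>D_ambient\<^esub> t) (scaled \<one>\<^bsub>D_ambient\<^esub> t') = 0" if "t \<in> T" "t' \<in> T" for t t'
      using that FR.norm_one by (simp add: group_dist_def)
    then show ?thesis
      unfolding D_set_iff cauchy_along_def by (auto simp del: one_product_group carrier_product_group)
  qed
  fix u v assume u: "u \<in> D_set G N T" and v: "v \<in> D_set G N T"
  have uv: "u \<otimes>\<^bsub>D_ambient\<^esub> v \<in> carrier D_ambient"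
    using u v unfolding D_set_iff by (intro D.m_closed) auto
  have "cauchy_along T FRdist (scaled (u \<otimes>\<^bsub>D_ambient\<^esub> v))"
    unfolding cauchy_along_def
  proof (intro allI impI)
    fix e :: real assume e: "0 < e"
    obtain K where K: "\<And>t t'. t \<in> T \<Longrightarrow> t' \<in> T \<Longrightarrow> t \<ge> K \<Longrightarrow> t' \<ge> K \<Longrightarrow>
        FRdist (scaled u t) (scaled u t') < e / 2"
      using cauchy_along_D[of T FRdist "scaled u" "e / 2"] u e by (auto simp: D_set_iff)
    obtain L where L: "\<And>t t'. t \<in> T \<Longrightarrow> t' \<in> T \<Longrightarrow> t \<ge> L \<Longrightarrow> t' \<ge> L \<Longrightarrow>
        FRdist (scaled v t) (scaled v t') < e / 2"
      using cauchy_along_D[of T FRdist "scaled v" "e / 2"] v e by (auto simp: D_set_iff)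
    show "\<exists>K. \<forall>t\<in>T. \<forall>t'\<in>T. t \<ge> K \<longrightarrow> t' \<ge> K \<longrightarrow>
        FRdist (scaled (u \<otimes>\<^bsub>D_ambient\<^esub> v) t) (scaled (u \<otimes>\<^bsub>D_ambient\<^esub> v) t') < e"
    proof (intro exI[of _ "max K L"] ballI impI)
      fix t t' assume t: "t \<in> T" "t' \<in> T" "t \<ge> max K L" "t' \<ge> max K L"
      have "FRdist (scaled (u \<otimes>\<^bsub>D_ambient\<^esub> v) t) (scaled (u \<otimes>\<^bsub>D_ambient\<^esub> v) t')
          \<le> FRdist (scaled u t) (scaled u t') + FRdist (scaled v t) (scaled v t')"
        using t D_closed[OF u] D_closed[OF v] FR.dist_mult by (simp del: mult_product_group add: D_ambient_mult)
      then show "FRdist (scaled (u \<otimes>\<^bsub>D_ambient\<^esub> v) t) (scaled (u \<otimes>\<^bsub>D_ambient\<^esub> v) t') < e"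
        using K[of t t'] L[of t t'] t by simp
    qed
  qed
  then show "u \<otimes>\<^bsub>D_ambient\<^esub> v \<in> D_set G N T"
    using uv by (simp add: D_set_iff)
next
  interpret D: group D_ambient
    by simp
  fix u assume u: "u \<in> D_set G N T"
  then have u': "u \<in> carrier D_ambient"
    by (simp add: D_set_iff)
  have "FRdist (scaled (inv\<^bsub>D_ambient\<^esub> u) t) (scaled (inv\<^bsub>D_ambient\<^esub> u) t')
      = FRdist (scaled u t) (scaled u t')" if "t \<in> T" "t' \<in> T" for t t'
    using that D_closed[OF u] D_ambient_inv[OF u'] FR.dist_inv by simp
  then show "inv\<^bsub>D_ambient\<^esub> u \<in> D_set G N T"
    using u D.inv_closed[OF u'] unfolding D_set_iff cauchy_along_def by metis
qed

lemma D_group_simps [simp]: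
  "carrier D_group = D_set G N T" "(\<otimes>\<^bsub>D_group\<^esub>) = (\<otimes>\<^bsub>D_ambient\<^esub>)" "\<one>\<^bsub>D_group\<^esub> = \<one>\<^bsub>D_ambient\<^esub>"
  by (simp_all add: D_group_def)

lemma D_group_inv: "w \<in> D_set G N T \<Longrightarrow> inv\<^bsub>D_group\<^esub> w = inv\<^bsub>D_ambient\<^esub> w"
  unfolding D_group_def by (rule group.m_inv_consistent[OF D_ambient_group subgroup_D_set])

lemma group_D_group: "group D_group"
  unfolding D_group_def by (rule group.subgroup_imp_group[OF D_ambient_group subgroup_D_set])

text \<open>
  The norm is 1-Lipschitz for its metric, so the norms of a Cauchy function are a Cauchy function
  of reals, and the limit that defines \<open>D_norm\<close> exists.
\<close>

lemma D_norm_tendsto: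
  assumes "w \<in> D_set G N T"
  shows "((\<lambda>t. FR_norm G N (scaled w t)) \<longlongrightarrow> D_norm G N T w) (along T)"
proof -
  have "cauchy_along T dist (\<lambda>t. FR_norm G N (scaled w t))"
    unfolding cauchy_along_def
  proof (intro allI impI)
    fix e :: real assume "0 < e"
    then obtain K where K: "\<And>t t'. t \<in> T \<Longrightarrow> t' \<in> T \<Longrightarrow> t \<ge> K \<Longrightarrow> t' \<ge> K \<Longrightarrow>
        FRdist (scaled w t) (scaled w t') < e"
      using cauchy_along_D[of T FRdist "scaled w" e] assms by (auto simp: D_set_iff)
    show "\<exists>K. \<forall>t\<in>T. \<forall>t'\<in>T. t \<ge> K \<longrightarrow> t' \<ge> K \<longrightarrow>
        dist (FR_norm G N (scaled w t)) (FR_norm G N (scaled w t')) < e"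
    proof (intro exI[of _ K] ballI impI)
      fix t t' assume t: "t \<in> T" "t' \<in> T" "t \<ge> K" "t' \<ge> K"
      have "dist (FR_norm G N (scaled w t)) (FR_norm G N (scaled w t'))
          \<le> FRdist (scaled w t) (scaled w t')"
        using FR.norm_diff_le_dist t D_closed[OF assms] by (simp add: dist_real_def)
      then show "dist (FR_norm G N (scaled w t)) (FR_norm G N (scaled w t')) < e"
        using K[of t t'] t by simp
    qed
  qed
  then obtain L where "((\<lambda>t. FR_norm G N (scaled w t)) \<longlongrightarrow> L) (along T)"
    using cauchy_along_real_convergent[OF scaling] by blast
  then show ?thesis
    unfolding D_norm_def using tendsto_Lim[OF along_nontrivial[OF scaling]] by metis
qed

lemma D_norm_le:
  assumes "w \<in> D_set G N T" "(b \<longlongrightarrow> B) (along T)" "\<And>t. t \<in> T \<Longrightarrow> FR_norm G N (scaled w t) \<le> b t"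
  shows "D_norm G N T w \<le> B"
  using along_nontrivial[OF scaling] assms(2) D_norm_tendsto[OF assms(1)]
  by (rule tendsto_le) (auto simp: eventually_along assms(3))

lemma D_norm_nonneg:
  assumes "w \<in> D_set G N T"
  shows "0 \<le> D_norm G N T w"
  using along_nontrivial[OF scaling] D_norm_tendsto[OF assms] tendsto_const
  by (rule tendsto_le) (auto simp: eventually_along D_closed[OF assms] FR.nonneg)

lemma D_norm_le_D_norm:
  assumes "u \<in> D_set G N T" "v \<in> D_set G N T"
    and "\<And>t. t \<in> T \<Longrightarrow> FR_norm G N (scaled u t) \<le> FR_norm G N (scaled v t)"
  shows "D_norm G N T u \<le> D_norm G N T v"
  using D_norm_le[OF assms(1) D_norm_tendsto[OF assms(2)] assms(3)] .

lemma pseudonormed_D_group: "pseudonormed_group D_group (D_norm G N T)"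
proof -
  interpret D: group D_group
    by (rule group_D_group)
  show ?thesis
  proof
    show "0 \<le> D_norm G N T w" if "w \<in> carrier D_group" for w
      using that D_norm_nonneg by simp
    show "D_norm G N T \<one>\<^bsub>D_group\<^esub> = 0"
    proof (rule antisym)
      have "FR_norm G N (scaled \<one>\<^bsub>D_group\<^esub> t) \<le> 0" if "t \<in> T" for t
        using that FR.norm_one by simp
      then show "D_norm G N T \<one>\<^bsub>D_group\<^esub> \<le> 0"
        using D.one_closed by (intro D_norm_le[OF _ tendsto_const]) auto
      show "0 \<le> D_norm G N T \<one>\<^bsub>D_group\<^esub>"
        using D.one_closed by (intro D_norm_nonneg) auto
    qed
    fix u assume "u \<in> carrier D_group"
    then have u: "u \<in> D_set G N T" "u \<in> carrier D_ambient"
      by (auto simp: D_set_iff)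
    have "FR_norm G N (scaled (inv\<^bsub>D_group\<^esub> u) t) = FR_norm G N (scaled u t)" if "t \<in> T" for t
      using that u D_closed[OF u(1)] D_ambient_inv[OF u(2)] by (simp add: D_group_inv FR.norm_inv)
    then show "D_norm G N T (inv\<^bsub>D_group\<^esub> u) = D_norm G N T u"
      using u D.inv_closed[of u] by (intro antisym D_norm_le_D_norm) auto
    fix v assume "v \<in> carrier D_group"
    then have v: "v \<in> D_set G N T" "v \<in> carrier D_ambient"
      by (auto simp: D_set_iff)
    show "D_norm G N T (u \<otimes>\<^bsub>D_group\<^esub> v) \<le> D_norm G N T u + D_norm G N T v"
    proof (rule D_norm_le)
      show "u \<otimes>\<^bsub>D_group\<^esub> v \<in> D_set G N T"
        using u v D.m_closed[of u v] by simp
      show "((\<lambda>t. FR_norm G N (scaled u t) + FR_norm G N (scaled v t))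
          \<longlongrightarrow> D_norm G N T u + D_norm G N T v) (along T)"
        by (intro tendsto_add D_norm_tendsto u v)
      show "FR_norm G N (scaled (u \<otimes>\<^bsub>D_group\<^esub> v) t)
          \<le> FR_norm G N (scaled u t) + FR_norm G N (scaled v t)" if "t \<in> T" for t
        using that D_closed[OF u(1)] D_closed[OF v(1)] by (simp add: FR.triangle)
    qed
    have "FR_norm G N (scaled (v \<otimes>\<^bsub>D_group\<^esub> u \<otimes>\<^bsub>D_group\<^esub> inv\<^bsub>D_group\<^esub> v) t) = FR_norm G N (scaled u t)"
      if "t \<in> T" for t
      using that u v D_closed[OF u(1)] D_closed[OF v(1)] D_ambient_inv[OF v(2)]
      by (simp add: D_group_inv FR.norm_conj)
    moreover have "v \<otimes>\<^bsub>D_group\<^esub> u \<otimes>\<^bsub>D_group\<^esub> inv\<^bsub>D_group\<^esub> v \<in> carrier D_group"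
      using u v by (intro D.m_closed D.inv_closed) simp_all
    ultimately show "D_norm G N T (v \<otimes>\<^bsub>D_group\<^esub> u \<otimes>\<^bsub>D_group\<^esub> inv\<^bsub>D_group\<^esub> v) = D_norm G N T u"
      using u by (intro antisym D_norm_le_D_norm) (simp_all del: mult_product_group)
  qed
qed

end

section \<open>The cone as a normed group\<close>

context cone_setup
begin

abbreviation "Pr \<equiv> compose T (proj G)"

abbreviation "C_ambient \<equiv> product_group T (\<lambda>_. G)"

lemma proj_closed: "w \<in> carrier (FZ G) \<Longrightarrow> proj G w \<in> carrier G"
  using proj_hom[OF is_group] by (auto simp: hom_def)

lemma Pr_ambient_hom: "group_hom D_ambient C_ambient Pr"
proof (intro group_hom.intro group_hom_axioms.intro homI)
  show "group D_ambient" "group C_ambient"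
    by (simp_all add: is_group)
  fix u assume u: "u \<in> carrier D_ambient"
  show "Pr u \<in> carrier C_ambient"
    using u by (auto simp: compose_def PiE_iff proj_closed)
  fix v assume v: "v \<in> carrier D_ambient"
  show "Pr (u \<otimes>\<^bsub>D_ambient\<^esub> v) = Pr u \<otimes>\<^bsub>C_ambient\<^esub> Pr v"
    using u v hom_mult[OF proj_hom[OF is_group]]
    by (intro ext) (auto simp: compose_def PiE_iff)
qed

lemma C_group_eq: "C_group G N T = C_ambient\<lparr>carrier := Pr ` D_set G N T\<rparr>"
  by (simp add: C_group_def)

lemma Pr_hom: "group_hom D_group (C_group G N T) Pr"
  unfolding C_group_eq D_group_def
  by (rule group_hom.induced_group_hom[OF Pr_ambient_hom subgroup_D_set])

lemma C_group_carrier: "carrier (C_group G N T) = Pr ` D_set G N T"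
  by (simp add: C_group_eq)

lemma C_norm_eq: "C_norm G N T = (\<lambda>g. Inf {D_norm G N T w | w. w \<in> carrier D_group \<and> Pr w = g})"
  by (simp add: C_norm_def fun_eq_iff)

text \<open>
  By definition \<open>C_norm\<close> is the quotient pseudonorm of \<open>D_norm\<close> along \<open>\<pi>\<close>.
\<close>

sublocale C: pseudonormed_group "C_group G N T" "C_norm G N T"
  unfolding C_norm_eq
proof (rule pseudonormed_group_quotient[OF pseudonormed_D_group])
  interpret Pr: group_hom D_group "C_group G N T" Pr
    by (rule Pr_hom)
  show "group (C_group G N T)" "Pr \<in> hom D_group (C_group G N T)"
    by (rule Pr.H.is_group, rule Pr.homh)
qed (simp add: C_group_carrier)

lemma C_closed:
  assumes "g \<in> carrier (C_group G N T)" "t \<in> T"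
  shows "g t \<in> carrier G"
proof -
  obtain w where "w \<in> D_set G N T" "g = Pr w"
    using assms by (auto simp: C_group_carrier)
  then show ?thesis
    using assms(2) by (auto simp: D_set_iff compose_def PiE_iff intro: proj_closed)
qed

lemma C_extensional: "g \<in> carrier (C_group G N T) \<Longrightarrow> g \<in> extensional T"
  by (auto simp: C_group_carrier)

lemma C_mult: "t \<in> T \<Longrightarrow> (g \<otimes>\<^bsub>C_group G N T\<^esub> h) t = g t \<otimes> h t"
  by (simp add: C_group_eq)

lemma C_norm_le: "w \<in> D_set G N T \<Longrightarrow> C_norm G N T (Pr w) \<le> D_norm G N T w"
  unfolding C_norm_def by (intro cInf_lower bdd_belowI[of _ 0]) (auto simp: D_norm_nonneg)

lemma C_norm_greatest:
  assumes "g \<in> carrier (C_group G N T)"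
    and "\<And>w. w \<in> D_set G N T \<Longrightarrow> Pr w = g \<Longrightarrow> c \<le> D_norm G N T w"
  shows "c \<le> C_norm G N T g"
  unfolding C_norm_def using assms by (intro cInf_greatest) (auto simp: C_group_carrier)

lemma normal_C_null: "normal (C_null G N T) (C_group G N T)"
  unfolding C_null_def by (rule C.normal_null)

abbreviation "cls \<equiv> cone_class G N T"

lemma cone_carrier: "carrier (cone G N T) = cls ` carrier (C_group G N T)"
  by (auto simp: cone_def cone_class_def FactGroup_def RCOSETS_def)

lemma cls_mult:
  assumes "g \<in> carrier (C_group G N T)" "h \<in> carrier (C_group G N T)"
  shows "cls g \<otimes>\<^bsub>cone G N T\<^esub> cls h = cls (g \<otimes>\<^bsub>C_group G N T\<^esub> h)"
  using assms by (simp add: cone_def cone_class_def normal.rcos_sum[OF normal_C_null])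

lemma mem_cls_iff:
  "x \<in> cls g \<longleftrightarrow> (\<exists>n\<in>C_null G N T. x = n \<otimes>\<^bsub>C_group G N T\<^esub> g)"
  by (auto simp: cone_class_def r_coset_def)

lemma cls_eq:
  assumes "g \<in> carrier (C_group G N T)" "x \<in> cls g"
  shows "cls x = cls g"
  using C.repr_independence[OF _ assms(1) normal_imp_subgroup[OF normal_C_null], of x] assms
  by (simp add: cone_class_def)

lemma self_mem_cls: "g \<in> carrier (C_group G N T) \<Longrightarrow> g \<in> cls g"
  unfolding cone_class_def by (rule C.rcos_self[OF _ normal_imp_subgroup[OF normal_C_null]])

text \<open>
  Factors of norm \<open>0\<close> do not change the norm, so the norm is constant on each coset.
\<close>

lemma cone_norm_cls:
  assumes "g \<in> carrier (C_group G N T)"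
  shows "cone_norm G N T (cls g) = C_norm G N T g"
proof -
  have "C_norm G N T x = C_norm G N T g" if "x \<in> cls g" for x
  proof -
    obtain n where "n \<in> carrier (C_group G N T)" "C_norm G N T n = 0" "x = n \<otimes>\<^bsub>C_group G N T\<^esub> g"
      using \<open>x \<in> cls g\<close> unfolding mem_cls_iff C_null_def by blast
    then show ?thesis
      by (simp only: C.norm_mult_null[OF _ assms])
  qed
  then have "C_norm G N T ` cls g = {C_norm G N T g}"
    using self_mem_cls[OF assms] by blast
  then show ?thesis
    by (simp add: cone_norm_def)
qed

text \<open>
  A bounded function \<open>k\<close> lifts to the letters \<open>k(t)\<close>, which after scaling have norm at most
  \<open>B / t\<close>; so it lies in the group and is null, however wildly it varies with \<open>t\<close>.
\<close>

lemma bounded_mem_C_null: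
  assumes k: "k \<in> T \<rightarrow>\<^sub>E carrier G" and B: "\<And>t. t \<in> T \<Longrightarrow> N (k t) \<le> B"
  shows "k \<in> C_null G N T"
proof -
  define w where "w = (\<lambda>t\<in>T. letter (k t) 1)"
  have kt: "k t \<in> carrier G" if "t \<in> T" for t
    using k that by auto
  have w_closed: "w t \<in> carrier (FR G)" if "t \<in> T" for t
    using that kt by (simp add: w_def)
  have bound: "FR_norm G N (scaled w t) \<le> B / t" if t: "t \<in> T" for t
  proof -
    have "scaled w t = letter (k t) (1 / t)"
      using t kt by (simp add: w_def psi_letter)
    then have "FR_norm G N (scaled w t) \<le> 1 / t * N (k t)"
      using FR_norm_letter_le[of G N "k t" "1 / t"] nonneg kt[OF t] T_pos[OF t] by simp
    also have "\<dots> \<le> B / t"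
      using B[OF t] T_pos[OF t] by (simp add: divide_right_mono)
    finally show ?thesis .
  qed
  have lim: "((\<lambda>t. B / t) \<longlongrightarrow> 0) (along T)"
    by (rule tendsto_mono[OF inf_le1 tendsto_divide_0[OF tendsto_const filterlim_at_top_imp_at_infinity[OF filterlim_ident]]])
  have "cauchy_along T FRdist (scaled w)"
    unfolding cauchy_along_def
  proof (intro allI impI)
    fix e :: real assume "0 < e"
    then have "eventually (\<lambda>t. B / t < e / 2) (along T)"
      using lim by (intro order_tendstoD) auto
    then obtain K where K: "\<And>t. t \<in> T \<Longrightarrow> t \<ge> K \<Longrightarrow> B / t < e / 2"
      unfolding eventually_along by blast
    show "\<exists>K. \<forall>t\<in>T. \<forall>t'\<in>T. t \<ge> K \<longrightarrow> t' \<ge> K \<longrightarrow> FRdist (scaled w t) (scaled w t') < e"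
    proof (intro exI[of _ K] ballI impI)
      fix t t' assume t: "t \<in> T" "t' \<in> T" "t \<ge> K" "t' \<ge> K"
      have "FRdist (scaled w t) (scaled w t') \<le> FR_norm G N (scaled w t) + FR_norm G N (scaled w t')"
        unfolding group_dist_def
        using FR.triangle[of "inv\<^bsub>FR G\<^esub> scaled w t" "scaled w t'"] t w_closed
        by (simp add: FR.norm_inv)
      then show "FRdist (scaled w t) (scaled w t') < e"
        using K[of t] K[of t'] bound[of t] bound[of t'] t by linarith
    qed
  qed
  moreover have "w \<in> carrier D_ambient"
    using kt by (simp add: w_def letter_FZ)
  ultimately have w: "w \<in> D_set G N T"
    by (simp only: D_set_iff)
  have Pr_w: "Pr w = k"
  proof (rule extensionalityI[where A = T])
    show "k \<in> extensional T"
      using k by (simp add: PiE_iff)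
  qed (simp_all add: compose_def w_def proj_letter[OF is_group] kt)
  then have k_closed: "k \<in> carrier (C_group G N T)"
    using w unfolding C_group_carrier by blast
  have "C_norm G N T k \<le> D_norm G N T w"
    using C_norm_le[OF w] unfolding Pr_w .
  also have "D_norm G N T w \<le> 0"
    by (rule D_norm_le[OF w lim bound])
  finally have "C_norm G N T k = 0"
    using C.nonneg[OF k_closed] by (rule antisym)
  then show ?thesis
    using k_closed unfolding C_null_def by blast
qed

end

section \<open>Lipschitz maps act on free products\<close>

lemma FZ_hom_eqI:
  assumes "group K" "p \<in> hom (FZ G) K" "q \<in> hom (FZ G) K"
    and letters: "\<And>g. g \<in> carrier G \<Longrightarrow> p (letter g 1) = q (letter g 1)"
    and "w \<in> carrier (FZ G)"
  shows "p w = q w"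
proof -
  interpret p: group_hom "FZ G" K p
    using assms by (intro group_hom.intro group_hom_axioms.intro group_FZ)
  interpret q: group_hom "FZ G" K q
    using assms by (intro group_hom.intro group_hom_axioms.intro group_FZ)
  have gen: "carrier (FZ G) = generate (FR G) ((\<lambda>g. letter g 1) ` carrier G)"
    by (simp add: FZ_def)
  show ?thesis
    using assms(5) unfolding gen
  proof induction
    case one
    then show ?case
      using p.hom_one q.hom_one by simp
  next
    case (incl h)
    then show ?case
      using letters by auto
  next
    case (inv h)
    then obtain g where g: "g \<in> carrier G" "h = letter g 1"
      by auto
    then show ?case
      using p.hom_inv[of h] q.hom_inv[of h] letters letter_FZ[OF g(1)] by simp
  next
    case (eng h1 h2)
    then show ?case
      using p.hom_mult[of h1 h2] q.hom_mult[of h1 h2] by (simp add: gen)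
  qed
qed

text \<open>
  The homomorphism of free products that sends the copy of the reals indexed by \<open>g\<close> to the copy
  indexed by \<open>\<phi> g\<close>.  Distinct copies satisfy no relations, so \<open>\<phi>\<close> may be an arbitrary
  map; this is what makes a section usable that is not a homomorphism.
\<close>

definition relabel :: "('b, 'y) monoid_scheme \<Rightarrow> ('a \<Rightarrow> 'b) \<Rightarrow> 'a rword \<Rightarrow> 'b rword" where
  "relabel H \<phi> = extend_letters (FR H) (\<lambda>g r. letter (\<phi> g) r)"

locale lipschitz_map = G: cone_setup G N T + H: cone_setup H M T
  for G :: "('a, 'x) monoid_scheme" and N and H :: "('b, 'y) monoid_scheme" and M and T +
  fixes \<phi> :: "'a \<Rightarrow> 'b" and C :: real
  assumes \<phi>_closed: "g \<in> carrier G \<Longrightarrow> \<phi> g \<in> carrier H"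
    and C_nonneg: "0 \<le> C"
    and lipschitz: "g \<in> carrier G \<Longrightarrow> M (\<phi> g) \<le> C * N g"
begin

lemma relabel_hom: "relabel H \<phi> \<in> hom (FR G) (FR H)"
proof -
  note * = extend_letters_mult[OF group_free_real[of "carrier H"], of UNIV "carrier G"
      "\<lambda>g r. letter (\<phi> g) r", OF _ _ letter_zero letter_mult[symmetric]]
  show ?thesis
    using *(1) *(3)[where v = "[]"]
    by (auto intro!: homI simp: relabel_def mult_free_real carrier_free_real \<phi>_closed)
qed

sublocale R: group_hom "FR G" "FR H" "relabel H \<phi>"
  by unfold_locales (rule relabel_hom)

lemma relabel_letter: "g \<in> carrier G \<Longrightarrow> relabel H \<phi> (letter g r) = letter (\<phi> g) r"
  unfolding relabel_def
  by (rule extend_letters_letter) (simp_all add: group_free_real \<phi>_closed letter_zero)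

lemma relabel_psi:
  assumes "x \<in> carrier (FR G)"
  shows "relabel H \<phi> (psi G r x) = psi H r (relabel H \<phi> x)"
  using assms
proof (induction rule: rword_induct)
  case one
  then show ?case
    by simp
next
  case (letter_mult g s x)
  then show ?case
    by (simp add: psi_letter relabel_letter \<phi>_closed)
qed

lemma relabel_FZ:
  assumes "w \<in> carrier (FZ G)"
  shows "relabel H \<phi> w \<in> carrier (FZ H)"
proof -
  let ?S = "(\<lambda>g. letter g 1) ` carrier G"
  have "?S \<subseteq> carrier (FR G)"
    by auto
  then have "relabel H \<phi> ` generate (FR G) ?S = generate (FR H) (relabel H \<phi> ` ?S)"
    by (rule R.generate_img[symmetric])
  also have "\<dots> \<subseteq> generate (FR H) ((\<lambda>h. letter h 1) ` carrier H)"
    by (rule H.FR.mono_generate) (auto simp: relabel_letter \<phi>_closed)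
  finally show ?thesis
    using assms by (auto simp: FZ_def)
qed

text \<open>
  An expression as a product of conjugates of letters is transported factor by factor, and the
  cost of each factor grows at most by the factor \<open>C\<close>.
\<close>

lemma relabel_cost:
  assumes "expr_cost G N x c"
  shows "\<exists>d\<le>C * c. expr_cost H M (relabel H \<phi> x) d"
  using assms
proof induction
  case one
  then show ?case
    using expr_cost.one[of H M] by auto
next
  case (step h g x c r)
  then obtain d where d: "d \<le> C * c" "expr_cost H M (relabel H \<phi> x) d"
    by blast
  have x: "x \<in> carrier (FR G)"
    using step.hyps(3) by (rule expr_cost_closed)
  have "\<bar>r\<bar> * M (\<phi> g) \<le> \<bar>r\<bar> * (C * N g)"
    using lipschitz[OF step.hyps(2)] by (intro mult_left_mono) auto
  then have "\<bar>r\<bar> * M (\<phi> g) + d \<le> C * (\<bar>r\<bar> * N g + c)"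
    using d(1) by (simp add: algebra_simps)
  moreover have "expr_cost H M (relabel H \<phi> ((h \<otimes>\<^bsub>FR G\<^esub> letter g r \<otimes>\<^bsub>FR G\<^esub> inv\<^bsub>FR G\<^esub> h) \<otimes>\<^bsub>FR G\<^esub> x))
      (\<bar>r\<bar> * M (\<phi> g) + d)"
    using expr_cost.step[OF R.hom_closed[OF step.hyps(1)] \<phi>_closed[OF step.hyps(2)] d(2), of r] step.hyps x
    by (simp add: relabel_letter)
  ultimately show ?case
    by blast
qed

lemma FR_norm_relabel:
  assumes x: "x \<in> carrier (FR G)"
  shows "FR_norm H M (relabel H \<phi> x) \<le> C * FR_norm G N x"
proof -
  have le: "FR_norm H M (relabel H \<phi> x) \<le> C * c" if c: "expr_cost G N x c" for c
  proof -
    obtain d where "d \<le> C * c" "expr_cost H M (relabel H \<phi> x) d"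
      using relabel_cost[OF c] by blast
    then show ?thesis
      using FR_norm_le[OF H.nonneg] by fastforce
  qed
  show ?thesis
  proof (cases "C = 0")
    case True
    then show ?thesis
      using le expr_cost_exists[OF x, of N] by auto
  next
    case False
    then have "FR_norm H M (relabel H \<phi> x) / C \<le> FR_norm G N x"
      using x le C_nonneg by (intro FR_norm_greatest[OF G.nonneg]) (auto simp: divide_le_eq mult.commute)
    then show ?thesis
      using False C_nonneg by (simp add: divide_le_eq mult.commute)
  qed
qed

lemma scaled_relabel:
  assumes "w \<in> D_set G N T" "t \<in> T"
  shows "H.scaled (compose T (relabel H \<phi>) w) t = relabel H \<phi> (G.scaled w t)"
  using assms G.D_closed[OF assms] by (simp add: compose_def relabel_psi)

lemma relabel_D_set:
  assumes w: "w \<in> D_set G N T"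
  shows "compose T (relabel H \<phi>) w \<in> D_set H M T"
proof -
  let ?v = "compose T (relabel H \<phi>) w"
  have "?v \<in> carrier H.D_ambient"
    using w by (auto simp: G.D_set_iff compose_def PiE_iff relabel_FZ)
  moreover have "cauchy_along T H.FRdist (H.scaled ?v)"
    unfolding cauchy_along_def
  proof (intro allI impI)
    fix e :: real assume e: "0 < e"
    \<comment> \<open>Dividing by \<open>C + 1\<close> rather than \<open>C\<close> covers \<open>C = 0\<close>.\<close>
    then have "0 < e / (C + 1)"
      using C_nonneg by simp
    then obtain K where K: "\<And>t t'. t \<in> T \<Longrightarrow> t' \<in> T \<Longrightarrow> t \<ge> K \<Longrightarrow> t' \<ge> K \<Longrightarrow>
        G.FRdist (G.scaled w t) (G.scaled w t') < e / (C + 1)"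
      using cauchy_along_D[of T G.FRdist "G.scaled w"] w unfolding G.D_set_iff by blast
    show "\<exists>K. \<forall>t\<in>T. \<forall>t'\<in>T. t \<ge> K \<longrightarrow> t' \<ge> K \<longrightarrow> H.FRdist (H.scaled ?v t) (H.scaled ?v t') < e"
    proof (intro exI[of _ K] ballI impI)
      fix t t' assume t: "t \<in> T" "t' \<in> T" "t \<ge> K" "t' \<ge> K"
      let ?x = "G.scaled w t" and ?y = "G.scaled w t'"
      have xy: "?x \<in> carrier (FR G)" "?y \<in> carrier (FR G)"
        using t G.D_closed[OF w] by simp_all
      have "H.FRdist (H.scaled ?v t) (H.scaled ?v t') = FR_norm H M (relabel H \<phi> (inv\<^bsub>FR G\<^esub> ?x \<otimes>\<^bsub>FR G\<^esub> ?y))"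
        unfolding scaled_relabel[OF w t(1)] scaled_relabel[OF w t(2)] group_dist_def using xy by simp
      also have "\<dots> \<le> C * G.FRdist ?x ?y"
        unfolding group_dist_def using xy by (intro FR_norm_relabel) simp
      also have "\<dots> \<le> C * (e / (C + 1))"
        using K[OF t] C_nonneg by (intro mult_left_mono) auto
      also have "\<dots> < e"
        using e C_nonneg by (simp add: field_simps)
      finally show "H.FRdist (H.scaled ?v t) (H.scaled ?v t') < e" .
    qed
  qed
  ultimately show ?thesis
    unfolding H.D_set_iff by blast
qed

lemma D_norm_relabel:
  assumes w: "w \<in> D_set G N T"
  shows "D_norm H M T (compose T (relabel H \<phi>) w) \<le> C * D_norm G N T w"
proof (rule H.D_norm_le[OF relabel_D_set[OF w]])
  show "((\<lambda>t. C * FR_norm G N (G.scaled w t)) \<longlongrightarrow> C * D_norm G N T w) (along T)"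
    by (intro tendsto_mult_left G.D_norm_tendsto w)
  show "FR_norm H M (H.scaled (compose T (relabel H \<phi>) w) t) \<le> C * FR_norm G N (G.scaled w t)"
    if "t \<in> T" for t
    unfolding scaled_relabel[OF w that] using that G.D_closed[OF w] by (intro FR_norm_relabel) simp
qed

end

section \<open>Maps that are homomorphisms up to a bounded kernel\<close>

context cone_setup
begin

text \<open>
  Two functions that agree modulo a bounded kernel differ by a bounded function, which is null.
\<close>

lemma cls_eq_mod_bounded:
  assumes q: "group_hom G Q q" and B: "\<And>x. x \<in> kernel G Q q \<Longrightarrow> N x \<le> B"
    and u: "u \<in> carrier (C_group G N T)" and v: "v \<in> T \<rightarrow>\<^sub>E carrier G"
    and eq: "\<And>t. t \<in> T \<Longrightarrow> q (v t) = q (u t)"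
  shows "v \<in> carrier (C_group G N T)" and "cls v = cls u"
proof -
  interpret q: group_hom G Q q
    by fact
  define k where "k = (\<lambda>t\<in>T. v t \<otimes> inv u t)"
  have closed: "u t \<in> carrier G" "v t \<in> carrier G" if "t \<in> T" for t
    using that v C_closed[OF u] by auto
  have "k \<in> C_null G N T"
  proof (rule bounded_mem_C_null)
    show "k \<in> T \<rightarrow>\<^sub>E carrier G"
      using closed by (simp add: k_def)
    show "N (k t) \<le> B" if "t \<in> T" for t
      using that closed eq by (intro B) (simp add: k_def kernel_def)
  qed
  moreover have v_eq: "v = k \<otimes>\<^bsub>C_group G N T\<^esub> u"
  proof (rule extensionalityI[where A = T])
    show "v \<in> extensional T"
      using v by (simp add: PiE_iff)
    show "k \<otimes>\<^bsub>C_group G N T\<^esub> u \<in> extensional T"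
      by (simp add: C_group_eq)
    show "v t = (k \<otimes>\<^bsub>C_group G N T\<^esub> u) t" if "t \<in> T" for t
      using that closed by (simp add: C_mult k_def m_assoc)
  qed
  ultimately have "v \<in> cls u"
    unfolding mem_cls_iff by blast
  then show "cls v = cls u"
    by (rule cls_eq[OF u])
  show "v \<in> carrier (C_group G N T)"
    using \<open>k \<in> C_null G N T\<close> u unfolding v_eq C_null_def by (intro C.m_closed) auto
qed

end

text \<open>
  A Lipschitz map \<open>\<phi>\<close> that becomes a homomorphism after composition with some \<open>q\<close> of bounded
  kernel.  Both the homomorphism \<open>f\<close> (with \<open>q\<close> the identity) and its section \<open>s\<close> (with
  \<open>q = f\<close>, as \<open>f \<circ> s\<close> is the identity) are of this kind.
\<close>

locale coarse_hom = lipschitz_map G N H M T \<phi> C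
  for G :: "('a, 'x) monoid_scheme" and N and H :: "('b, 'y) monoid_scheme" and M and T
    and \<phi> and C +
  fixes Q :: "('c, 'z) monoid_scheme" and q :: "'b \<Rightarrow> 'c" and B :: real
  assumes q_hom: "group_hom H Q q"
    and bounded: "x \<in> kernel H Q q \<Longrightarrow> M x \<le> B"
    and q\<phi>_hom: "(\<lambda>g. q (\<phi> g)) \<in> hom G Q"
begin

interpretation q: group_hom H Q q
  by (rule q_hom)

text \<open>
  \<open>relabel H \<phi>\<close> covers \<open>\<phi>\<close> only up to the kernel of \<open>q\<close>: after applying \<open>q\<close>, both ways
  around the square are homomorphisms on the free group \<open>F(G)\<close>, and on a generator both give
  \<open>q (\<phi> g)\<close>.
\<close>

lemma q_proj_relabel:
  assumes "w \<in> carrier (FZ G)"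
  shows "q (proj H (relabel H \<phi> w)) = q (\<phi> (proj G w))"
proof -
  have relabel: "relabel H \<phi> \<in> hom (FZ G) (FZ H)"
    using R.homh by (auto simp: hom_def relabel_FZ FZ_closed)
  let ?l = "q \<circ> (proj H \<circ> relabel H \<phi>)" and ?r = "(\<lambda>g. q (\<phi> g)) \<circ> proj G"
  have "?l w = ?r w"
  proof (rule FZ_hom_eqI[OF q.H.is_group _ _ _ assms])
    show "?l \<in> hom (FZ G) Q"
      by (rule hom_compose[OF hom_compose[OF relabel proj_hom[OF H.is_group]] q.homh])
    show "?r \<in> hom (FZ G) Q"
      by (rule hom_compose[OF proj_hom[OF G.is_group] q\<phi>_hom])
    show "?l (letter g 1) = ?r (letter g 1)" if "g \<in> carrier G" for g
      using that by (simp add: relabel_letter proj_letter G.is_group H.is_group \<phi>_closed)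
  qed
  then show ?thesis
    by simp
qed

lemma compose_PiE:
  assumes "g \<in> carrier (C_group G N T)"
  shows "compose T \<phi> g \<in> T \<rightarrow>\<^sub>E carrier H"
  using G.C_closed[OF assms] \<phi>_closed by (simp add: compose_def)

text \<open>
  Relabelling a lift \<open>w\<close> of \<open>g\<close> need not give a lift of \<open>\<phi> \<circ> g\<close>, but it gives a lift of a
  function that agrees with \<open>\<phi> \<circ> g\<close> modulo the kernel of \<open>q\<close>, hence has the same class
  and the same norm.
\<close>

lemma compose_lift:
  assumes w: "w \<in> D_set G N T"
  shows "compose T \<phi> (G.Pr w) \<in> carrier (C_group H M T)"
    and "C_norm H M T (compose T \<phi> (G.Pr w)) \<le> C * D_norm G N T w"
proof -
  let ?g = "G.Pr w" and ?v = "compose T (relabel H \<phi>) w"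
  let ?u = "H.Pr ?v"
  have g: "?g \<in> carrier (C_group G N T)"
    using w by (simp add: G.C_group_carrier)
  have u: "?u \<in> carrier (C_group H M T)"
    using relabel_D_set[OF w] by (simp add: H.C_group_carrier)
  have eq: "q (compose T \<phi> ?g t) = q (?u t)" if "t \<in> T" for t
    using that w q_proj_relabel[of "w t"] by (simp add: compose_def G.D_set_iff PiE_iff)
  note * = H.cls_eq_mod_bounded[OF q_hom bounded u compose_PiE[OF g] eq]
  show closed: "compose T \<phi> ?g \<in> carrier (C_group H M T)"
    by (rule *(1))
  have "C_norm H M T (compose T \<phi> ?g) = C_norm H M T ?u"
    using H.cone_norm_cls[OF closed] H.cone_norm_cls[OF u] *(2) by simp
  also have "\<dots> \<le> D_norm H M T ?v"
    by (rule H.C_norm_le[OF relabel_D_set[OF w]])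
  also have "\<dots> \<le> C * D_norm G N T w"
    by (rule D_norm_relabel[OF w])
  finally show "C_norm H M T (compose T \<phi> ?g) \<le> C * D_norm G N T w" .
qed

lemma compose_closed:
  assumes "g \<in> carrier (C_group G N T)"
  shows "compose T \<phi> g \<in> carrier (C_group H M T)"
  using assms compose_lift(1) by (auto simp: G.C_group_carrier)

lemma C_norm_compose:
  assumes g: "g \<in> carrier (C_group G N T)"
  shows "C_norm H M T (compose T \<phi> g) \<le> C * C_norm G N T g"
proof (cases "C = 0")
  case True
  then show ?thesis
    using g compose_lift(2) by (auto simp: G.C_group_carrier)
next
  case False
  then have "C_norm H M T (compose T \<phi> g) / C \<le> C_norm G N T g"
    using C_nonneg compose_lift(2)
    by (intro G.C_norm_greatest g) (auto simp: divide_le_eq mult.commute)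
  then show ?thesis
    using False C_nonneg by (simp add: divide_le_eq mult.commute)
qed

lemma cls_compose_mult:
  assumes g: "g \<in> carrier (C_group G N T)" and h: "h \<in> carrier (C_group G N T)"
  shows "H.cls (compose T \<phi> (g \<otimes>\<^bsub>C_group G N T\<^esub> h)) =
    H.cls (compose T \<phi> g \<otimes>\<^bsub>C_group H M T\<^esub> compose T \<phi> h)"
proof (rule H.cls_eq_mod_bounded(2)[OF q_hom bounded])
  show "compose T \<phi> g \<otimes>\<^bsub>C_group H M T\<^esub> compose T \<phi> h \<in> carrier (C_group H M T)"
    using g h by (intro H.C.m_closed compose_closed)
  show "compose T \<phi> (g \<otimes>\<^bsub>C_group G N T\<^esub> h) \<in> T \<rightarrow>\<^sub>E carrier H"
    using g h by (intro compose_PiE G.C.m_closed)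
  show "q (compose T \<phi> (g \<otimes>\<^bsub>C_group G N T\<^esub> h) t) =
      q ((compose T \<phi> g \<otimes>\<^bsub>C_group H M T\<^esub> compose T \<phi> h) t)" if "t \<in> T" for t
    using that G.C_closed[OF g that] G.C_closed[OF h that] hom_mult[OF q\<phi>_hom]
    by (simp add: G.C_mult H.C_mult compose_def \<phi>_closed)
qed

text \<open>
  Two representatives of a class differ by a null factor, whose image is null by the Lipschitz
  estimate; on classes \<open>\<phi>\<close> is multiplicative, so the images have the same class.
\<close>

lemma cone_map_cls:
  assumes g: "g \<in> carrier (C_group G N T)"
  shows "cone_map G N H M T \<phi> (G.cls g) = H.cls (compose T \<phi> g)"
proof -
  have "H.cls (compose T \<phi> x) = H.cls (compose T \<phi> g)" if x: "x \<in> G.cls g" for x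
  proof -
    obtain n where n: "n \<in> carrier (C_group G N T)" "C_norm G N T n = 0"
      and x: "x = n \<otimes>\<^bsub>C_group G N T\<^esub> g"
      using x unfolding G.mem_cls_iff C_null_def by blast
    have "C_norm H M T (compose T \<phi> n) = 0"
      using C_norm_compose[OF n(1)] H.C.nonneg[OF compose_closed[OF n(1)]] n(2) by simp
    then have "compose T \<phi> n \<in> C_null H M T"
      using compose_closed[OF n(1)] by (simp add: C_null_def)
    then have "compose T \<phi> n \<otimes>\<^bsub>C_group H M T\<^esub> compose T \<phi> g \<in> H.cls (compose T \<phi> g)"
      unfolding H.mem_cls_iff by blast
    then show ?thesis
      unfolding x cls_compose_mult[OF n(1) g] by (rule H.cls_eq[OF compose_closed[OF g]])
  qed
  then have "(\<lambda>x. H.cls (compose T \<phi> x)) ` G.cls g = {H.cls (compose T \<phi> g)}"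
    using G.self_mem_cls[OF g] by blast
  then show ?thesis
    by (simp add: cone_map_def)
qed

lemma cone_map_well_defined: "cone_map_well_defined G N H M T \<phi>"
  unfolding cone_map_well_defined_def using compose_closed cone_map_cls by blast

lemma cone_map_hom: "cone_map G N H M T \<phi> \<in> hom (cone G N T) (cone H M T)"
proof (rule homI)
  fix X assume "X \<in> carrier (cone G N T)"
  then obtain g where g: "g \<in> carrier (C_group G N T)" and X: "X = G.cls g"
    by (auto simp: G.cone_carrier)
  show "cone_map G N H M T \<phi> X \<in> carrier (cone H M T)"
    unfolding X cone_map_cls[OF g] H.cone_carrier using compose_closed[OF g] by blast
  fix Y assume "Y \<in> carrier (cone G N T)"
  then obtain h where h: "h \<in> carrier (C_group G N T)" and Y: "Y = G.cls h"
    by (auto simp: G.cone_carrier)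
  show "cone_map G N H M T \<phi> (X \<otimes>\<^bsub>cone G N T\<^esub> Y) =
      cone_map G N H M T \<phi> X \<otimes>\<^bsub>cone H M T\<^esub> cone_map G N H M T \<phi> Y"
    unfolding X Y G.cls_mult[OF g h] cone_map_cls[OF g] cone_map_cls[OF h]
      cone_map_cls[OF G.C.m_closed[OF g h]] cls_compose_mult[OF g h]
    by (rule H.cls_mult[OF compose_closed[OF g] compose_closed[OF h], symmetric])
qed

lemma cone_map_lipschitz:
  "norm_lipschitz (cone G N T) (cone_norm G N T) (cone_norm H M T) C (cone_map G N H M T \<phi>)"
  unfolding norm_lipschitz_def
proof
  fix X assume "X \<in> carrier (cone G N T)"
  then obtain g where g: "g \<in> carrier (C_group G N T)" and X: "X = G.cls g"
    by (auto simp: G.cone_carrier)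
  show "cone_norm H M T (cone_map G N H M T \<phi> X) \<le> C * cone_norm G N T X"
    unfolding X cone_map_cls[OF g] H.cone_norm_cls[OF compose_closed[OF g]] G.cone_norm_cls[OF g]
    by (rule C_norm_compose[OF g])
qed

end

section \<open>The isomorphism of cones\<close>

lemma (in cone_setup) C_norm_eq_zero:
  assumes N: "\<And>g. g \<in> carrier G \<Longrightarrow> N g = 0" and g: "g \<in> carrier (C_group G N T)"
  shows "C_norm G N T g = 0"
proof -
  have "g \<in> C_null G N T"
  proof (rule bounded_mem_C_null)
    show "g \<in> T \<rightarrow>\<^sub>E carrier G"
      using C_closed[OF g] C_extensional[OF g] by (simp add: PiE_iff)
    show "N (g t) \<le> 0" if "t \<in> T" for t
      using N[OF C_closed[OF g that]] by simp
  qed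
  then show ?thesis
    by (simp add: C_null_def)
qed

text \<open>
  A negative constant \<open>C\<close> forces the norm of the domain to vanish, so replacing \<open>C\<close> by
  \<open>max C 0\<close> loses nothing.
\<close>

lemma (in cone_setup) norm_lipschitz_cone_max:
  assumes lip: "norm_lipschitz G N M C \<phi>" and M: "\<And>g. g \<in> carrier G \<Longrightarrow> 0 \<le> M (\<phi> g)"
    and cone: "norm_lipschitz (cone G N T) (cone_norm G N T) L (max C 0) \<Phi>"
  shows "norm_lipschitz (cone G N T) (cone_norm G N T) L C \<Phi>"
proof (cases "0 \<le> C")
  case True
  then show ?thesis
    using cone by (simp add: max_def)
next
  case False
  have "N g = 0" if "g \<in> carrier G" for g
  proof -
    have "0 \<le> C * N g"
      using lip M[OF that] that by (force simp: norm_lipschitz_def)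
    then show ?thesis
      using False nonneg[OF that] by (auto simp: zero_le_mult_iff)
  qed
  then have "cone_norm G N T X = 0" if "X \<in> carrier (cone G N T)" for X
    using that C_norm_eq_zero by (auto simp: cone_carrier cone_norm_cls)
  then show ?thesis
    using cone False by (simp add: norm_lipschitz_def)
qed

theorem theorem7p4:
  fixes G :: "('a, 'x) monoid_scheme" and H :: "('b, 'y) monoid_scheme"
    and normG :: "'a \<Rightarrow> real" and normH :: "'b \<Rightarrow> real"
    and T :: "real set" and f :: "'a \<Rightarrow> 'b" and s :: "'b \<Rightarrow> 'a" and C C' :: real
  assumes "group G" "group_norm G normG" "conj_invariant G normG"
    and "group H" "group_norm H normH" "conj_invariant H normH"
    and "scaling_set T"
    and "f \<in> epi G H" "norm_lipschitz G normG normH C f"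
    and "norm_bounded G normG (kernel G H f)"
    and "\<forall>h\<in>carrier H. s h \<in> carrier G \<and> f (s h) = h"
    and "norm_lipschitz H normH normG C' s"
  shows "cone_map_well_defined G normG H normH T f \<and>
         cone_map G normG H normH T f \<in> iso (cone G normG T) (cone H normH T) \<and>
         norm_lipschitz (cone G normG T) (cone_norm G normG T) (cone_norm H normH T) C
           (cone_map G normG H normH T f) \<and>
         cone_map_well_defined H normH G normG T s \<and>
         cone_map H normH G normG T s \<in> hom (cone H normH T) (cone G normG T) \<and>
         (\<forall>x\<in>carrier (cone G normG T).
           cone_map H normH G normG T s (cone_map G normG H normH T f x) = x) \<and>
         (\<forall>y\<in>carrier (cone H normH T).
           cone_map G normG H normH T f (cone_map H normH G normG T s y) = y) \<and>
         norm_lipschitz (cone H normH T) (cone_norm H normH T) (cone_norm G normG T) C'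
           (cone_map H normH G normG T s)"
proof -
  interpret G: cone_setup G normG T
    using assms by (intro cone_setup.intro pseudonormed_groupI cone_setup_axioms.intro)
  interpret H: cone_setup H normH T
    using assms by (intro cone_setup.intro pseudonormed_groupI cone_setup_axioms.intro)
  interpret f: group_hom G H f
    using assms(8) by unfold_locales (auto simp: epi_def)
  have f_closed: "f g \<in> carrier H" if "g \<in> carrier G" for g
    using that by simp
  have s_closed: "s h \<in> carrier G" and fs: "f (s h) = h" if "h \<in> carrier H" for h
    using that assms(11) by auto
  have f_lip: "normH (f g) \<le> max C 0 * normG g" if "g \<in> carrier G" for g
  proof -
    have "normH (f g) \<le> C * normG g"
      using that assms(9) by (simp add: norm_lipschitz_def)
    also have "\<dots> \<le> max C 0 * normG g"
      using G.nonneg[OF that] by (intro mult_right_mono) auto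
    finally show ?thesis .
  qed
  have s_lip: "normG (s h) \<le> max C' 0 * normH h" if "h \<in> carrier H" for h
  proof -
    have "normG (s h) \<le> C' * normH h"
      using that assms(12) by (simp add: norm_lipschitz_def)
    also have "\<dots> \<le> max C' 0 * normH h"
      using H.nonneg[OF that] by (intro mult_right_mono) auto
    finally show ?thesis .
  qed
  obtain B where B: "\<And>x. x \<in> kernel G H f \<Longrightarrow> normG x \<le> B"
  proof -
    obtain B where "\<forall>x\<in>kernel G H f. \<forall>y\<in>kernel G H f. group_dist G normG x y \<le> B"
      using assms(10) by (auto simp: norm_bounded_def)
    moreover have "\<one>\<^bsub>G\<^esub> \<in> kernel G H f"
      by (simp add: kernel_def)
    ultimately have "normG x \<le> B" if "x \<in> kernel G H f" for x
      using that by (fastforce simp: group_dist_def kernel_def)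
    then show ?thesis
      using that by blast
  qed
  have id_hom: "group_hom H H (\<lambda>h. h)"
    by unfold_locales (auto simp: hom_def)
  \<comment> \<open>The kernel of the identity is trivial, hence bounded by \<open>0\<close>.\<close>
  interpret F: coarse_hom G normG H normH T f "max C 0" H "\<lambda>h. h" 0
  proof (intro coarse_hom.intro lipschitz_map.intro lipschitz_map_axioms.intro
      coarse_hom_axioms.intro G.cone_setup_axioms H.cone_setup_axioms id_hom)
    show "normH x \<le> 0" if "x \<in> kernel H H (\<lambda>h. h)" for x
      using that H.norm_one by (simp add: kernel_def)
  qed (use f_lip f.homh in auto)
  interpret S: coarse_hom H normH G normG T s "max C' 0" H f B
  proof (intro coarse_hom.intro lipschitz_map.intro lipschitz_map_axioms.intro
      coarse_hom_axioms.intro G.cone_setup_axioms H.cone_setup_axioms f.group_hom_axioms B)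
    show "(\<lambda>h. f (s h)) \<in> hom H H"
      using fs by (auto simp: hom_def)
  qed (use s_lip s_closed in auto)
  let ?f = "cone_map G normG H normH T f" and ?s = "cone_map H normH G normG T s"
  have sf: "?s (?f X) = X" if "X \<in> carrier (cone G normG T)" for X
  proof -
    obtain g where g: "g \<in> carrier (C_group G normG T)" and X: "X = G.cls g"
      using \<open>X \<in> _\<close> by (auto simp: G.cone_carrier)
    have fg: "compose T f g \<in> carrier (C_group H normH T)"
      by (rule F.compose_closed[OF g])
    \<comment> \<open>\<open>s \<circ> f\<close> is the identity only modulo \<open>ker f\<close>, which the cone does not see.\<close>
    have eq: "f (compose T s (compose T f g) t) = f (g t)" if "t \<in> T" for t
      using that G.C_closed[OF g that] fs by (simp add: compose_def)
    have "G.cls (compose T s (compose T f g)) = G.cls g"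
      by (rule G.cls_eq_mod_bounded(2)[OF f.group_hom_axioms B g S.compose_PiE[OF fg] eq])
    then show ?thesis
      unfolding X F.cone_map_cls[OF g] S.cone_map_cls[OF fg] .
  qed
  have fs': "?f (?s Y) = Y" if "Y \<in> carrier (cone H normH T)" for Y
  proof -
    obtain h where h: "h \<in> carrier (C_group H normH T)" and Y: "Y = H.cls h"
      using \<open>Y \<in> _\<close> by (auto simp: H.cone_carrier)
    have sh: "compose T s h \<in> carrier (C_group G normG T)"
      by (rule S.compose_closed[OF h])
    have "compose T f (compose T s h) = h"
    proof (rule extensionalityI[where A = T])
      show "h \<in> extensional T"
        by (rule H.C_extensional[OF h])
    qed (simp_all add: compose_def fs H.C_closed[OF h])
    then show ?thesis
      unfolding Y S.cone_map_cls[OF h] F.cone_map_cls[OF sh] by simp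
  qed
  have "bij_betw ?f (carrier (cone G normG T)) (carrier (cone H normH T))"
  proof (rule bij_betw_byWitness[where f' = ?s])
    show "?f ` carrier (cone G normG T) \<subseteq> carrier (cone H normH T)"
      using F.cone_map_hom by (auto simp: hom_def)
    show "?s ` carrier (cone H normH T) \<subseteq> carrier (cone G normG T)"
      using S.cone_map_hom by (auto simp: hom_def)
  qed (use sf fs' in auto)
  then have "?f \<in> iso (cone G normG T) (cone H normH T)"
    using F.cone_map_hom by (simp add: iso_def)
  moreover have "norm_lipschitz (cone G normG T) (cone_norm G normG T) (cone_norm H normH T) C ?f"
    using G.norm_lipschitz_cone_max[OF assms(9) _ F.cone_map_lipschitz] H.nonneg f_closed by blast
  moreover have "norm_lipschitz (cone H normH T) (cone_norm H normH T) (cone_norm G normG T) C' ?s"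
    using H.norm_lipschitz_cone_max[OF assms(12) _ S.cone_map_lipschitz] G.nonneg s_closed by blast
  ultimately show ?thesis
    using F.cone_map_well_defined S.cone_map_well_defined S.cone_map_hom sf fs' by blast
qed

end
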